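(* A (finite-dimensional real) nilpotent Lie algebra $\mathfrak{g}$ admits an anti-quasi-Sasakian structure of maximal rank if and only if $\mathfrak{g}$ is isomorphic to a weighted Heisenberg Lie algebra $\mathfrak{h}^{4n+1}_\lambda$ for some $n$ and some non-zero weights $\lambda_1,\dots,\lambda_n\in\mathbb{R}$.
   Context: An almost contact metric structure on a real Lie algebra $\mathfrak{g}$ of dimension $2m+1$ is a quadruple $(\varphi,\xi,\eta,g)$ with $\varphi$ an endomorphism of the vector space $\mathfrak{g}$, $\xi\in\mathfrak{g}$, $\eta\in\mathfrak{g}^*$, and $g$ an inner product, such that $\varphi^2=-I+\eta\otimes\xi$, $\eta(\xi)=1$, $g(\varphi X,\varphi Y)=g(X,Y)-\eta(X)\eta(Y)$. Its fundamental $2$-form is $\Phi(X,Y)=g(X,\varphi Y)$. The differential is the Chevalley–Eilenberg one: $d\eta(X,Y)=-\eta([X,Y])$ and $d\Phi(X,Y,Z)=-\Phi([X,Y],Z)-\Phi([Y,Z],X)-\Phi([Z,X],Y)$. Put $N_\varphi(X,Y)=[\varphi X,\varphi Y]+\varphi^2[X,Y]-\varphi[X,\varphi Y]-\varphi[\varphi X,Y]+d\eta(X,Y)\xi$. The structure is anti-quasi-Sasakian if $d\Phi=0$ and $N_\varphi=2\,d\eta\otimes\xi$. It has maximal rank if $\eta\wedge(d\eta)^m\neq 0$. For $\lambda=(\lambda_1,\dots,\lambda_n)\in\mathbb{R}^n$, the weighted Heisenberg Lie algebra $\mathfrak{h}^{4n+1}_\lambda$ with weights $\lambda_1,\dots,\lambda_n$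 is the $(4n+1)$-dimensional real Lie algebra with basis $\{\xi,\tau_r,\tau_{n+r},\tau_{2n+r},\tau_{3n+r} : r=1,\dots,n\}$ whose only possibly nonvanishing brackets of basis elements (up to skew-symmetry) are $[\tau_r,\tau_{3n+r}]=[\tau_{n+r},\tau_{2n+r}]=2\lambda_r\xi$, $r=1,\dots,n$. *)

theory Defs
  imports "HOL-Analysis.Analysis" "HOL-Analysis.Finite_Function_Topology" "HOL-Combinatorics.Permutations"
begin

section \<open>Real Lie algebras\<close>

text \<open>A real Lie algebra is given by a linear subspace of an ambient real vector space together
  with a bracket; only the values of the bracket on that subspace matter.\<close>

locale lie_algebra =
  fixes L :: "'a::real_vector set" and br :: "'a \<Rightarrow> 'a \<Rightarrow> 'a"
  assumes subspace_carrier: "subspace L"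
    and bracket_closed: "x \<in> L \<Longrightarrow> y \<in> L \<Longrightarrow> br x y \<in> L"
    and bracket_add_left: "x \<in> L \<Longrightarrow> y \<in> L \<Longrightarrow> z \<in> L \<Longrightarrow> br (x + y) z = br x z + br y z"
    and bracket_add_right: "x \<in> L \<Longrightarrow> y \<in> L \<Longrightarrow> z \<in> L \<Longrightarrow> br x (y + z) = br x y + br x z"
    and bracket_scale_left: "x \<in> L \<Longrightarrow> y \<in> L \<Longrightarrow> br (c *\<^sub>R x) y = c *\<^sub>R br x y"
    and bracket_scale_right: "x \<in> L \<Longrightarrow> y \<in> L \<Longrightarrow> br x (c *\<^sub>R y) = c *\<^sub>R br x y"
    and bracket_self: "x \<in> L \<Longrightarrow> br x x = 0"
    and jacobi: "x \<in> L \<Longrightarrow> y \<in> L \<Longrightarrow> z \<in> L \<Longrightarrow>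
      br x (br y z) + br y (br z x) + br z (br x y) = 0"

primrec lower_central_series ::
    "'a::real_vector set \<Rightarrow> ('a \<Rightarrow> 'a \<Rightarrow> 'a) \<Rightarrow> nat \<Rightarrow> 'a set" where
  "lower_central_series L br 0 = L"
| "lower_central_series L br (Suc k) = span {br x y | x y. x \<in> L \<and> y \<in> lower_central_series L br k}"

definition lie_nilpotent :: "'a::real_vector set \<Rightarrow> ('a \<Rightarrow> 'a \<Rightarrow> 'a) \<Rightarrow> bool" where
  "lie_nilpotent L br \<longleftrightarrow> (\<exists>k. lower_central_series L br k = {0})"

definition lie_isomorphic ::
    "'a::real_vector set \<Rightarrow> ('a \<Rightarrow> 'a \<Rightarrow> 'a) \<Rightarrow> 'b::real_vector set \<Rightarrow> ('b \<Rightarrow> 'b \<Rightarrow> 'b) \<Rightarrow> bool" where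
  "lie_isomorphic L br M br' \<longleftrightarrow>
    (\<exists>f. bij_betw f L M \<and>
      (\<forall>x\<in>L. \<forall>y\<in>L. f (x + y) = f x + f y) \<and>
      (\<forall>c. \<forall>x\<in>L. f (c *\<^sub>R x) = c *\<^sub>R f x) \<and>
      (\<forall>x\<in>L. \<forall>y\<in>L. f (br x y) = br' (f x) (f y)))"

section \<open>Exterior forms and the Chevalley--Eilenberg differential\<close>

text \<open>A \<open>k\<close>-form is represented by a function of a sequence of vectors that only looks at the
  entries \<open>0, \<dots>, k - 1\<close>.\<close>

definition one_form :: "('a \<Rightarrow> real) \<Rightarrow> (nat \<Rightarrow> 'a) \<Rightarrow> real" where
  "one_form \<alpha> v = \<alpha> (v 0)"

definition two_form :: "('a \<Rightarrow> 'a \<Rightarrow> real) \<Rightarrow> (nat \<Rightarrow> 'a) \<Rightarrow> real" where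
  "two_form \<omega> v = \<omega> (v 0) (v 1)"

definition wedge ::
    "nat \<Rightarrow> nat \<Rightarrow> ((nat \<Rightarrow> 'a) \<Rightarrow> real) \<Rightarrow> ((nat \<Rightarrow> 'a) \<Rightarrow> real) \<Rightarrow> (nat \<Rightarrow> 'a) \<Rightarrow> real" where
  "wedge p q \<alpha> \<beta> v =
    (\<Sum>\<sigma> | \<sigma> permutes {..<p + q}.
        of_int (sign \<sigma>) * \<alpha> (\<lambda>i. v (\<sigma> i)) * \<beta> (\<lambda>i. v (\<sigma> (p + i)))) / (fact p * fact q)"

primrec two_form_power :: "('a \<Rightarrow> 'a \<Rightarrow> real) \<Rightarrow> nat \<Rightarrow> (nat \<Rightarrow> 'a) \<Rightarrow> real" where
  "two_form_power \<omega> 0 = (\<lambda>v. 1)"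
| "two_form_power \<omega> (Suc k) = wedge 2 (2 * k) (two_form \<omega>) (two_form_power \<omega> k)"

definition ce_d1 :: "('a \<Rightarrow> 'a \<Rightarrow> 'a) \<Rightarrow> ('a \<Rightarrow> real) \<Rightarrow> 'a \<Rightarrow> 'a \<Rightarrow> real" where
  "ce_d1 br \<alpha> X Y = - \<alpha> (br X Y)"

definition ce_d2 ::
    "('a \<Rightarrow> 'a \<Rightarrow> 'a) \<Rightarrow> ('a \<Rightarrow> 'a \<Rightarrow> real) \<Rightarrow> 'a \<Rightarrow> 'a \<Rightarrow> 'a \<Rightarrow> real" where
  "ce_d2 br \<omega> X Y Z = - \<omega> (br X Y) Z - \<omega> (br Y Z) X - \<omega> (br Z X) Y"

section \<open>Almost contact metric structures\<close>

text \<open>From here on the Lie algebra is a whole type, i.e. its carrier is \<^term>\<open>UNIV\<close>.\<close>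

definition is_inner_product :: "('a::real_vector \<Rightarrow> 'a \<Rightarrow> real) \<Rightarrow> bool" where
  "is_inner_product g \<longleftrightarrow>
    bilinear g \<and> (\<forall>x y. g x y = g y x) \<and> (\<forall>x. x \<noteq> 0 \<longrightarrow> 0 < g x x)"

locale almost_contact_metric =
  fixes m :: nat
    and \<phi> :: "'a::real_vector \<Rightarrow> 'a"
    and \<xi> :: 'a
    and \<eta> :: "'a \<Rightarrow> real"
    and g :: "'a \<Rightarrow> 'a \<Rightarrow> real"
  assumes dim_odd: "dim (UNIV :: 'a set) = 2 * m + 1"
    and linear_phi: "linear \<phi>"
    and linear_eta: "linear \<eta>"
    and inner_product: "is_inner_product g"
    and phi_phi: "\<phi> (\<phi> X) = - X + \<eta> X *\<^sub>R \<xi>"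
    and eta_xi: "\<eta> \<xi> = 1"
    and compatible: "g (\<phi> X) (\<phi> Y) = g X Y - \<eta> X * \<eta> Y"

definition fundamental_form :: "('a \<Rightarrow> 'a) \<Rightarrow> ('a \<Rightarrow> 'a \<Rightarrow> real) \<Rightarrow> 'a \<Rightarrow> 'a \<Rightarrow> real" where
  "fundamental_form \<phi> g X Y = g X (\<phi> Y)"

definition N_tensor ::
    "('a::real_vector \<Rightarrow> 'a \<Rightarrow> 'a) \<Rightarrow> ('a \<Rightarrow> 'a) \<Rightarrow> 'a \<Rightarrow> ('a \<Rightarrow> real) \<Rightarrow> 'a \<Rightarrow> 'a \<Rightarrow> 'a" where
  "N_tensor br \<phi> \<xi> \<eta> X Y =
    br (\<phi> X) (\<phi> Y) + \<phi> (\<phi> (br X Y)) - \<phi> (br X (\<phi> Y)) - \<phi> (br (\<phi> X) Y) + ce_d1 br \<eta> X Y *\<^sub>R \<xi>"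

locale anti_quasi_sasakian =
  almost_contact_metric m \<phi> \<xi> \<eta> g
  for br :: "'a::real_vector \<Rightarrow> 'a \<Rightarrow> 'a"
    and m :: nat and \<phi> :: "'a \<Rightarrow> 'a" and \<xi> :: 'a
    and \<eta> :: "'a \<Rightarrow> real" and g :: "'a \<Rightarrow> 'a \<Rightarrow> real" +
  assumes fundamental_form_closed: "ce_d2 br (fundamental_form \<phi> g) X Y Z = 0"
    and N_eq: "N_tensor br \<phi> \<xi> \<eta> X Y = (2 * ce_d1 br \<eta> X Y) *\<^sub>R \<xi>"

definition maximal_rank :: "('a \<Rightarrow> 'a \<Rightarrow> 'a) \<Rightarrow> nat \<Rightarrow> ('a \<Rightarrow> real) \<Rightarrow> bool" where
  "maximal_rank br m \<eta> \<longleftrightarrow>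
    wedge 1 (2 * m) (one_form \<eta>) (two_form_power (ce_d1 br \<eta>) m) \<noteq> (\<lambda>v. 0)"

section \<open>Weighted Heisenberg Lie algebras\<close>

text \<open>The algebra is realised on the span of \<open>4 n + 1\<close> unit vectors in the space of finitely
  supported sequences; index \<open>0\<close> is used for \<open>\<xi>\<close> and index \<open>i \<ge> 1\<close> for \<open>\<tau>\<^sub>i\<close>. The bracket is
  written in coordinates; its values on the basis are derived below.\<close>

definition heis_xi :: "(nat \<Rightarrow>\<^sub>0 real)" where
  "heis_xi = Poly_Mapping.single 0 1"

definition heis_tau :: "nat \<Rightarrow> (nat \<Rightarrow>\<^sub>0 real)" where
  "heis_tau i = Poly_Mapping.single i 1"

definition heis_carrier :: "nat \<Rightarrow> (nat \<Rightarrow>\<^sub>0 real) set" where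
  "heis_carrier n = span (insert heis_xi (heis_tau ` {1..4 * n}))"

definition heis_bracket ::
    "nat \<Rightarrow> (nat \<Rightarrow> real) \<Rightarrow> (nat \<Rightarrow>\<^sub>0 real) \<Rightarrow> (nat \<Rightarrow>\<^sub>0 real) \<Rightarrow> (nat \<Rightarrow>\<^sub>0 real)" where
  "heis_bracket n w x y =
    (\<Sum>r = 1..n. 2 * w r *
      (Poly_Mapping.lookup x r * Poly_Mapping.lookup y (3 * n + r)
       - Poly_Mapping.lookup x (3 * n + r) * Poly_Mapping.lookup y r
       + Poly_Mapping.lookup x (n + r) * Poly_Mapping.lookup y (2 * n + r)
       - Poly_Mapping.lookup x (2 * n + r) * Poly_Mapping.lookup y (n + r))) *\<^sub>R heis_xi"

lemma lookup_scaleR: "Poly_Mapping.lookup (c *\<^sub>R x) i = c * Poly_Mapping.lookup (x :: (nat \<Rightarrow>\<^sub>0 real)) i"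
  by (simp add: scaleR_poly_mapping_def)

lemma heis_bracket_skew: "heis_bracket n w y x = - heis_bracket n w x y"
  unfolding heis_bracket_def scaleR_minus_left[symmetric] sum_negf[symmetric]
  by (intro arg_cong[where f = "\<lambda>c. c *\<^sub>R heis_xi"] sum.cong) (auto simp: algebra_simps)

lemma heis_bracket_xi: "heis_bracket n w heis_xi x = 0"
  by (auto simp: heis_bracket_def heis_xi_def lookup_single when_def simp del: single_one intro!: sum.neutral)

lemma heis_bracket_tau:
  assumes "i \<in> {1..4 * n}" "j \<in> {1..4 * n}" "i < j"
  shows "heis_bracket n w (heis_tau i) (heis_tau j) =
    (if i \<in> {1..n} \<and> j = 3 * n + i then (2 * w i) *\<^sub>R heis_xi
     else if i \<in> {n + 1..2 * n} \<and> j = n + i then (2 * w (i - n)) *\<^sub>R heis_xi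
     else 0)"
proof -
  have lookup_tau: "Poly_Mapping.lookup (heis_tau l) k = (if k = l then 1 else 0)" for k l
    by (auto simp: heis_tau_def lookup_single when_def)
  let ?c = "\<lambda>k. if k = i then 1 else (0::real)" and ?d = "\<lambda>k. if k = j then 1 else (0::real)"
  let ?s = "\<lambda>r. 2 * w r * (?c r * ?d (3 * n + r) + ?c (n + r) * ?d (2 * n + r))"
  have "(\<Sum>r = 1..n. 2 * w r *
      (?c r * ?d (3 * n + r) - ?c (3 * n + r) * ?d r
       + ?c (n + r) * ?d (2 * n + r) - ?c (2 * n + r) * ?d (n + r))) = (\<Sum>r = 1..n. ?s r)"
    by (rule sum.cong) (use assms in auto)
  also have "\<dots> = (\<Sum>r = 1..n. (if r = i then (if j = 3 * n + i then 2 * w i else 0) else 0) +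
      (if r = i - n then (if n < i \<and> j = n + i then 2 * w (i - n) else 0) else 0))"
    by (rule sum.cong) (use assms in auto)
  also have "\<dots> = (if i \<in> {1..n} \<and> j = 3 * n + i then 2 * w i
     else if i \<in> {n + 1..2 * n} \<and> j = n + i then 2 * w (i - n) else 0)"
    by (auto simp: sum.distrib)
  finally show ?thesis
    by (simp add: heis_bracket_def lookup_tau)
qed

lemma dim_heis_carrier: "dim (heis_carrier n) = 4 * n + 1"
proof -
  let ?e = "\<lambda>i. Poly_Mapping.single i 1 :: (nat \<Rightarrow>\<^sub>0 real)"
  have "{0..4 * n} = insert 0 {1..4 * n}" by auto
  then have eq: "insert heis_xi (heis_tau ` {1..4 * n}) = ?e ` {0..4 * n}"
    unfolding heis_xi_def heis_tau_def by (metis image_insert)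
  have inj: "inj_on ?e {0..4 * n}"
    by (auto intro!: inj_onI simp: poly_mapping_eq_iff fun_eq_iff lookup_single when_def split: if_splits)
  have "independent (?e ` {0..4 * n})"
  proof (subst independent_explicit_finite_subsets, intro allI impI ballI)
    fix A u v assume A: "A \<subseteq> ?e ` {0..4 * n}" "finite A" "(\<Sum>v\<in>A. u v *\<^sub>R v) = 0" "v \<in> A"
    then obtain i where i: "v = ?e i" by auto
    have "0 = Poly_Mapping.lookup (\<Sum>v\<in>A. u v *\<^sub>R v) i" using A by simp
    also have "\<dots> = (\<Sum>v\<in>A. u v * Poly_Mapping.lookup v i)" by (simp add: lookup_sum lookup_scaleR)
    also have "\<dots> = (\<Sum>x\<in>A. if x = v then u v else 0)"
      using A(1) i by (intro sum.cong refl) (auto dest!: subsetD simp: lookup_single when_def simp del: single_one split: if_splits)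
    also have "\<dots> = u v" using A by simp
    finally show "u v = 0" by simp
  qed
  then have "dim (span (?e ` {0..4 * n})) = card (?e ` {0..4 * n})"
    by (simp add: dim_eq_card_independent)
  then show ?thesis unfolding heis_carrier_def eq using inj by (simp add: card_image)
qed

lemma lie_algebra_heis: "lie_algebra (heis_carrier n) (heis_bracket n w)"
proof
  let ?B = "heis_bracket n w"
  have xi: "heis_xi \<in> heis_carrier n" by (auto simp: heis_carrier_def intro: span_base)
  show "subspace (heis_carrier n)" by (simp add: heis_carrier_def)
  show "?B x y \<in> heis_carrier n" for x y
    using xi by (simp add: heis_bracket_def heis_carrier_def span_scale)
  show add: "?B (x + y) z = ?B x z + ?B y z" for x y z
    unfolding heis_bracket_def scaleR_add_left[symmetric] sum.distrib[symmetric]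
    by (intro arg_cong[where f = "\<lambda>c. c *\<^sub>R heis_xi"] sum.cong) (auto simp: lookup_add algebra_simps)
  show "?B x (y + z) = ?B x y + ?B x z" for x y z
    using add[of y z x] heis_bracket_skew[of n w x] by simp
  show scale: "?B (c *\<^sub>R x) y = c *\<^sub>R ?B x y" for c x y
    unfolding heis_bracket_def scaleR_scaleR sum_distrib_left
    by (intro arg_cong[where f = "\<lambda>c. c *\<^sub>R heis_xi"] sum.cong) (auto simp: lookup_scaleR algebra_simps)
  show "?B x (c *\<^sub>R y) = c *\<^sub>R ?B x y" for c x y
    using scale[of c y x] heis_bracket_skew[of n w x] by simp
  show "?B x x = 0" for x
    by (auto simp: heis_bracket_def)
  have "?B x (?B y z) = 0" for x y z
    using scale[of _ heis_xi x] heis_bracket_skew[of n w x "?B y z"]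
    by (simp add: heis_bracket_xi heis_bracket_def[of n w y z])
  then show "?B x (?B y z) + ?B y (?B z x) + ?B z (?B x y) = 0" for x y z by simp
qed

end

(*
  Let (\<phi>, \<xi>, \<eta>, g) be an anti-quasi-Sasakian structure of maximal rank on a nilpotent algebra.
  The form d\<eta> is \<phi>-anti-invariant, so \<xi> is in its kernel, and ad \<xi> is g-skew; being
  nilpotent it vanishes, so \<xi> is central. The quotient by \<xi> is a nilpotent Kaehler Lie
  algebra, which is shown to be abelian by a trace argument: unimodularity and d\<Phi> = 0 give
  \<Sum> [e, \<phi> e] = 0 over an orthonormal basis, and from this the center is orthogonal to the
  derived algebra. Hence [x, y] = - d\<eta>(x, y) \<xi>, where d\<eta> is nondegenerate on ker \<eta> by maximal
  rank. Being anti-invariant, d\<eta> is the real part of a complex symplectic form on (ker \<eta>, \<phi>), and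
  a complex Darboux basis exhibits the weighted Heisenberg algebra. As no orthonormality is
  needed for an isomorphism, all weights can even be taken equal to 1/2.
*)
theory Submission
  imports Defs
begin

section \<open>Wedge products and maximal rank\<close>

text \<open>The right-hand side of N = 2 d\<eta> \<otimes> \<xi> is decisive: N = 0 would make
  d\<eta> \<phi>-invariant, while here the sign is reversed, and this is what makes d\<eta> the real
  part of a complex bilinear form. Orthogonality of center and derived algebra ends the argument
  because the last nonzero term of the lower central series of a non-abelian nilpotent algebra lies
  in both. The weights are no isomorphism invariants: rescaling the third and fourth block of the
  basis absorbs them, and 1/2 is the value for which the brackets 2 \<lambda> \<xi> become \<xi>.
  Maximal rank is stated through wedge products, that is, sums over all permutations. Their values
  are never computed: a top form annihilated by a nonzero vector is zero, and on a symplectic basis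
  all summands are nonnegative, so that nothing cancels. For the converse the Heisenberg basis is
  declared orthonormal, and \<phi> rotates the first block into the second and the third into the
  fourth.\<close>

text \<open>Antisymmetry comes from summing over the full symmetric group: the substitution of
  \<tau> \<circ> \<sigma> for \<sigma> permutes the summands and multiplies every sign by that of
  \<tau>.\<close>

lemma wedge_permute:
  assumes "\<tau> permutes {..<p + q}"
  shows "wedge p q \<alpha> \<beta> (\<lambda>i. v (\<tau> i)) = of_int (sign \<tau>) * wedge p q \<alpha> \<beta> v"
proof -
  let ?t = "\<lambda>\<sigma>. of_int (sign \<sigma>) * \<alpha> (\<lambda>i. v (\<sigma> i)) * \<beta> (\<lambda>i. v (\<sigma> (p + i)))"
  have t: "of_int (sign \<sigma>) * \<alpha> (\<lambda>i. v (\<tau> (\<sigma> i))) * \<beta> (\<lambda>i. v (\<tau> (\<sigma> (p + i)))) =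
      of_int (sign \<tau>) * ?t (\<tau> \<circ> \<sigma>)" if "\<sigma> permutes {..<p + q}" for \<sigma>
  proof -
    have "sign (\<tau> \<circ> \<sigma>) = sign \<tau> * sign \<sigma>"
      using assms that by (intro sign_compose) (auto intro: permutation_permutes[THEN iffD2])
    then show ?thesis by (simp add: sign_def)
  qed
  have "(\<Sum>\<sigma> | \<sigma> permutes {..<p + q}.
      of_int (sign \<sigma>) * \<alpha> (\<lambda>i. v (\<tau> (\<sigma> i))) * \<beta> (\<lambda>i. v (\<tau> (\<sigma> (p + i))))) =
    of_int (sign \<tau>) * (\<Sum>\<sigma> | \<sigma> permutes {..<p + q}. ?t (\<tau> \<circ> \<sigma>))"
    unfolding sum_distrib_left by (rule sum.cong) (simp_all add: t)
  also have "\<dots> = of_int (sign \<tau>) * (\<Sum>\<sigma> | \<sigma> permutes {..<p + q}. ?t \<sigma>)"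
    by (simp add: setum_permutations_compose_left[OF assms, of ?t])
  finally show ?thesis by (simp add: wedge_def)
qed

lemma wedge_repeated:
  assumes "v a = v b" "a < p + q" "b < p + q" "a \<noteq> b"
  shows "wedge p q \<alpha> \<beta> v = 0"
proof -
  have "Transposition.transpose a b permutes {..<p + q}"
    using assms by (intro permutes_swap_id) auto
  then have "wedge p q \<alpha> \<beta> (\<lambda>i. v (Transposition.transpose a b i)) = of_int (sign (Transposition.transpose a b)) * wedge p q \<alpha> \<beta> v"
    by (rule wedge_permute)
  moreover have "(\<lambda>i. v (Transposition.transpose a b i)) = v"
    using assms by (auto simp: Transposition.transpose_def)
  ultimately show ?thesis
    using \<open>a \<noteq> b\<close> by (simp add: sign_swap_id)
qed

lemma two_form_power_permute:
  assumes "\<tau> permutes {..<2 * k}"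
  shows "two_form_power \<omega> k (\<lambda>i. v (\<tau> i)) = of_int (sign \<tau>) * two_form_power \<omega> k v"
proof (cases k)
  case 0
  with assms show ?thesis by simp
next
  case (Suc l)
  with assms show ?thesis by (simp add: wedge_permute)
qed

text \<open>Serves to pull a permutation of the later slots out of the second factor of a wedge.
  Induction over transpositions works because each of them shifts down by \<open>p\<close> to a
  transposition of \<open>{..<k}\<close>, so no sign of a conjugated permutation has to be
  found.\<close>

lemma alternating_shift_permute:
  fixes F :: "(nat \<Rightarrow> 'a) \<Rightarrow> real"
  assumes alt: "\<And>\<tau> v. \<tau> permutes {..<k} \<Longrightarrow> F (\<lambda>i. v (\<tau> i)) = of_int (sign \<tau>) * F v"
    and \<tau>: "\<tau> permutes {p..<p + k}"
  shows "F (\<lambda>i. v (\<tau> (p + i))) = of_int (sign \<tau>) * F (\<lambda>i. v (p + i))"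
  using finite_atLeastLessThan \<tau>
proof (induction rule: permutes_rev_induct)
  case id
  then show ?case by simp
next
  case (swap a b \<rho>)
  let ?t = "Transposition.transpose (a - p) (b - p)"
  have eq: "Transposition.transpose a b (p + i) = p + ?t i" for i
    using swap by (auto simp: Transposition.transpose_def)
  have t: "?t permutes {..<k}"
    using swap by (intro permutes_swap_id) auto
  have ne: "a - p \<noteq> b - p" using swap by auto
  have "sign (\<rho> \<circ> Transposition.transpose a b) = - sign \<rho>"
    using swap by (subst sign_compose)
      (auto simp: sign_swap_id permutation_swap_id intro: permutation_permutes[THEN iffD2])
  moreover have "F (\<lambda>i. v (\<rho> (p + ?t i))) = - F (\<lambda>i. v (\<rho> (p + i)))"
    using alt[OF t, of "\<lambda>i. v (\<rho> (p + i))"] ne by (simp add: sign_swap_id)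
  ultimately show ?case
    using swap.IH by (simp add: eq comp_def)
qed

text \<open>A summand survives only if the first two slots receive the two members of one pair; the
  remaining slots then carry the other pairs, to which the induction hypothesis applies. All
  surviving summands are positive, and the identity gives one of them.\<close>

lemma two_form_power_pos:
  assumes skew: "\<And>x y. \<omega> x y = - \<omega> y x"
    and "\<And>i. i < k \<Longrightarrow> 0 < \<omega> (v (2 * i)) (v (2 * i + 1))"
    and "\<And>a b. a < 2 * k \<Longrightarrow> b < 2 * k \<Longrightarrow> a div 2 \<noteq> b div 2 \<Longrightarrow> \<omega> (v a) (v b) = 0"
  shows "0 < two_form_power \<omega> k v"
  using assms(2,3)
proof (induction k arbitrary: v)
  case 0
  then show ?case by simp
next
  case (Suc k)
  define t where "t \<sigma> = of_int (sign \<sigma>) * two_form \<omega> (\<lambda>i. v (\<sigma> i)) *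
    two_form_power \<omega> k (\<lambda>i. v (\<sigma> (2 + i)))" for \<sigma>
  let ?P = "{\<sigma>. \<sigma> permutes {..<2 + 2 * k}}"
  have pos: "0 < t \<sigma>" if \<sigma>: "\<sigma> permutes {..<2 + 2 * k}" "\<sigma> 0 = 2 * j" "\<sigma> 1 = 2 * j + 1" for \<sigma> j
  proof -
    have "\<sigma> 0 < 2 + 2 * k" using permutes_in_image[OF \<sigma>(1), of 0] by simp
    then have j: "j < Suc k" using \<sigma> by simp
    \<comment> \<open>Exchanging the pair \<open>(0, 1)\<close> with the pair
      \<open>(2 * j, 2 * j + 1)\<close> takes two transpositions. Hence \<rho> is an even
      involution, and \<rho> \<circ> \<sigma> has the sign of \<sigma> and fixes 0 and 1.\<close>
    define \<rho> where "\<rho> = Transposition.transpose 0 (2 * j) \<circ> Transposition.transpose 1 (2 * j + 1)"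
    have \<rho>: "\<rho> permutes {..<2 + 2 * k}"
      unfolding \<rho>_def using j by (intro permutes_compose permutes_swap_id) auto
    have \<rho>\<rho>: "\<rho> (\<rho> i) = i" for i
      unfolding \<rho>_def by (auto simp: Transposition.transpose_def; presburger)
    have sgn: "sign \<rho> = 1"
      unfolding \<rho>_def by (subst sign_compose) (auto simp: sign_swap_id permutation_swap_id)
    define \<tau> where "\<tau> = \<rho> \<circ> \<sigma>"
    have \<tau>01: "\<tau> 0 = 0" "\<tau> 1 = 1"
      using \<sigma> unfolding \<tau>_def \<rho>_def by (auto simp: Transposition.transpose_def; presburger)+
    have "\<tau> permutes {..<2 + 2 * k}"
      unfolding \<tau>_def using \<sigma>(1) \<rho> by (rule permutes_compose)
    moreover have "\<tau> x = x" if "x \<in> {..<2 + 2 * k} - {2..<2 + 2 * k}" for x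
    proof -
      have "x = 0 \<or> x = 1" using that by auto
      with \<tau>01 show ?thesis by auto
    qed
    ultimately have \<tau>: "\<tau> permutes {2..<2 + 2 * k}"
      by (rule permutes_superset)
    have \<sigma>\<tau>: "\<sigma> i = \<rho> (\<tau> i)" for i
      by (simp add: \<tau>_def \<rho>\<rho>)
    have "sign \<tau> = sign \<sigma>"
      unfolding \<tau>_def using \<sigma> \<rho> by (subst sign_compose)
        (auto simp: sgn intro: permutation_permutes[THEN iffD2])
    moreover have "two_form_power \<omega> k (\<lambda>i. v (\<sigma> (2 + i))) =
        of_int (sign \<tau>) * two_form_power \<omega> k (\<lambda>i. v (\<rho> (2 + i)))"
      unfolding \<sigma>\<tau>
      using alternating_shift_permute[where F = "two_form_power \<omega> k", OF two_form_power_permute \<tau>, where v = "\<lambda>i. v (\<rho> i)"] by simp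
    moreover have "of_int (sign \<tau>) * (of_int (sign \<tau>) :: real) = 1"
      by (simp add: sign_def)
    ultimately have "t \<sigma> = \<omega> (v (2 * j)) (v (2 * j + 1)) * two_form_power \<omega> k (\<lambda>i. v (\<rho> (2 + i)))"
      using \<sigma> by (simp add: t_def two_form_def algebra_simps)
    moreover have "0 < two_form_power \<omega> k (\<lambda>i. v (\<rho> (2 + i)))"
    proof (rule Suc.IH)
      \<comment> \<open>Once pair \<open>j\<close> has moved to the front, the pair
        \<open>(0, 1)\<close> sits in its old place and all other pairs stay put, so the tail is
        again a list of pairs.\<close>
      have \<rho>val: "\<rho> (2 + i) = (if i + 2 = 2 * j then 0 else if i + 2 = 2 * j + 1 then 1 else i + 2)" for i
        unfolding \<rho>_def by (auto simp: Transposition.transpose_def)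
      show "0 < \<omega> (v (\<rho> (2 + 2 * i))) (v (\<rho> (2 + (2 * i + 1))))" if "i < k" for i
      proof (cases "i + 1 = j")
        case True
        then show ?thesis unfolding \<rho>val using Suc.prems(1)[of 0] by auto
      next
        case False
        then have "\<rho> (2 + 2 * i) = 2 * (i + 1)" "\<rho> (2 + (2 * i + 1)) = 2 * (i + 1) + 1"
          unfolding \<rho>val by presburger+
        then show ?thesis using Suc.prems(1)[of "i + 1"] that by simp
      qed
      show "\<omega> (v (\<rho> (2 + a))) (v (\<rho> (2 + b))) = 0"
        if "a < 2 * k" "b < 2 * k" "a div 2 \<noteq> b div 2" for a b
      proof (rule Suc.prems(2))
        show "\<rho> (2 + a) < 2 * Suc k" "\<rho> (2 + b) < 2 * Suc k"
          unfolding \<rho>val using that by auto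
        show "\<rho> (2 + a) div 2 \<noteq> \<rho> (2 + b) div 2"
          unfolding \<rho>val using that by (auto split: if_splits; presburger)
      qed
    qed
    ultimately show ?thesis using Suc.prems(1)[of j] j by simp
  qed
  have nonneg: "0 \<le> t \<sigma>" if \<sigma>: "\<sigma> \<in> ?P" for \<sigma>
  proof -
    have \<sigma>p: "\<sigma> permutes {..<2 + 2 * k}" using \<sigma> by simp
    have lt: "\<sigma> 0 < 2 * Suc k" "\<sigma> 1 < 2 * Suc k"
      using permutes_in_image[OF \<sigma>p, of 0] permutes_in_image[OF \<sigma>p, of 1] by simp_all
    have "inj \<sigma>" using \<sigma>p by (rule permutes_inj)
    then have ne: "\<sigma> 0 \<noteq> \<sigma> 1" by (auto dest: injD)
    define j where "j = \<sigma> 0 div 2"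
    consider "\<sigma> 0 div 2 \<noteq> \<sigma> 1 div 2" | "\<sigma> 0 = 2 * j" "\<sigma> 1 = 2 * j + 1"
      | "\<sigma> 1 = 2 * j" "\<sigma> 0 = 2 * j + 1"
    proof -
      have "a div 2 \<noteq> b div 2 \<or> a = 2 * (a div 2) \<and> b = 2 * (a div 2) + 1 \<or>
          b = 2 * (a div 2) \<and> a = 2 * (a div 2) + 1" if "a \<noteq> b" for a b :: nat
        using that by (cases "even a"; cases "even b"; fastforce elim!: evenE oddE)
      then show ?thesis using that ne unfolding j_def by blast
    qed
    then show ?thesis
    proof cases
      case 1
      then show ?thesis using Suc.prems(2)[OF lt] by (simp add: t_def two_form_def)
    next
      case 2
      with pos[OF \<sigma>p] show ?thesis by (simp add: less_imp_le)
    next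
      case 3
      \<comment> \<open>For a reversed pair, swapping the first two slots flips both the sign of
        \<sigma> and that of \<omega>, which leaves the summand unchanged.\<close>
      let ?\<sigma> = "\<sigma> \<circ> Transposition.transpose 0 1"
      have tr: "Transposition.transpose 0 1 permutes {..<2 + 2 * k}" by (intro permutes_swap_id) auto
      have "sign ?\<sigma> = - sign \<sigma>"
        using \<sigma>p by (subst sign_compose)
          (auto simp: sign_swap_id permutation_swap_id intro: permutation_permutes[THEN iffD2])
      moreover have "?\<sigma> (2 + i) = \<sigma> (2 + i)" for i by (simp add: transpose_def)
      ultimately have "t ?\<sigma> = t \<sigma>"
        unfolding t_def two_form_def using skew[of "v (\<sigma> 1)" "v (\<sigma> 0)"] by simp
      moreover have "0 < t ?\<sigma>"
        using permutes_compose[OF tr \<sigma>p] by (rule pos[of _ j]) (use 3 in simp_all)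
      ultimately show ?thesis by simp
    qed
  qed
  have "0 < sum t ?P"
  proof (rule sum_pos2[of _ id])
    show "0 < t id" by (rule pos[of _ 0]) (auto simp: permutes_id)
  qed (use nonneg in \<open>auto simp: finite_permutations permutes_id\<close>)
  then show ?case
    unfolding t_def by (simp add: wedge_def)
qed

section \<open>Multilinear forms and the vectors that annihilate them\<close>

text \<open>Forms take infinite sequences. The first clause keeps one factor of a wedge constant
  while a slot belonging to the other factor varies.\<close>

definition multilinear_form :: "nat \<Rightarrow> ((nat \<Rightarrow> 'a::real_vector) \<Rightarrow> real) \<Rightarrow> bool" where
  "multilinear_form k \<alpha> \<longleftrightarrow>
    (\<forall>v w. (\<forall>i<k. v i = w i) \<longrightarrow> \<alpha> v = \<alpha> w) \<and> (\<forall>v. \<forall>j<k. linear (\<lambda>x. \<alpha> (v(j := x))))"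

lemma multilinear_form_cong:
  "multilinear_form k \<alpha> \<Longrightarrow> (\<And>i. i < k \<Longrightarrow> v i = w i) \<Longrightarrow> \<alpha> v = \<alpha> w"
  by (auto simp: multilinear_form_def)

text \<open>In the summand of \<sigma>, slot \<open>j\<close> is argument number
  \<open>inv \<sigma> j\<close>, which belongs to exactly one of the two factors; the other factor
  is a constant.\<close>

lemma multilinear_form_wedge:
  assumes \<alpha>: "multilinear_form p \<alpha>" and \<beta>: "multilinear_form q \<beta>"
  shows "multilinear_form (p + q) (wedge p q \<alpha> \<beta>)"
  unfolding multilinear_form_def
proof (intro conjI allI impI)
  fix v w :: "nat \<Rightarrow> 'a" assume eq: "\<forall>i<p + q. v i = w i"
  have "\<sigma> i < p + q" if "\<sigma> permutes {..<p + q}" "i < p + q" for \<sigma> i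
    using permutes_in_image[OF that(1), of i] that(2) by simp
  then have "\<alpha> (\<lambda>i. v (\<sigma> i)) = \<alpha> (\<lambda>i. w (\<sigma> i))" "\<beta> (\<lambda>i. v (\<sigma> (p + i))) = \<beta> (\<lambda>i. w (\<sigma> (p + i)))"
    if "\<sigma> permutes {..<p + q}" for \<sigma>
    using that eq by (auto intro!: multilinear_form_cong[OF \<alpha>] multilinear_form_cong[OF \<beta>])
  then show "wedge p q \<alpha> \<beta> v = wedge p q \<alpha> \<beta> w"
    unfolding wedge_def by simp
next
  fix v :: "nat \<Rightarrow> 'a" and j assume j: "j < p + q"
  have "linear (\<lambda>x. of_int (sign \<sigma>) * \<alpha> (\<lambda>i. (v(j := x)) (\<sigma> i)) * \<beta> (\<lambda>i. (v(j := x)) (\<sigma> (p + i))))"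
    if \<sigma>: "\<sigma> permutes {..<p + q}" for \<sigma>
  proof -
    define l where "l = inv \<sigma> j"
    have "\<sigma> l = j" unfolding l_def using \<sigma> by (rule permutes_inverses)
    then have \<sigma>l: "\<sigma> i = j \<longleftrightarrow> i = l" for i
      using permutes_inj[OF \<sigma>] by (auto dest: injD)
    have "l < p + q" using permutes_in_image[OF \<sigma>, of l] j \<open>\<sigma> l = j\<close> by simp
    then consider "l < p" | l' where "l = p + l'" "l' < q"
      by (metis add_less_cancel_left le_Suc_ex not_less)
    then show ?thesis
    proof cases
      case 1
      have "\<alpha> (\<lambda>i. (v(j := x)) (\<sigma> i)) = \<alpha> ((\<lambda>i. v (\<sigma> i))(l := x))" for x
        by (rule arg_cong[where f = \<alpha>]) (auto simp: \<sigma>l)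
      moreover have "\<beta> (\<lambda>i. (v(j := x)) (\<sigma> (p + i))) = \<beta> (\<lambda>i. v (\<sigma> (p + i)))" for x
        by (rule arg_cong[where f = \<beta>]) (use 1 in \<open>auto simp: \<sigma>l\<close>)
      moreover have "linear (\<lambda>x. \<alpha> ((\<lambda>i. v (\<sigma> i))(l := x)))"
        using \<alpha> 1 unfolding multilinear_form_def by blast
      ultimately show ?thesis
        by (simp add: linear_iff algebra_simps)
    next
      case 2
      have "\<alpha> (\<lambda>i. (v(j := x)) (\<sigma> i)) = \<alpha> (\<lambda>i. v (\<sigma> i))" for x
        by (rule multilinear_form_cong[OF \<alpha>]) (use 2 in \<open>auto simp: \<sigma>l\<close>)
      moreover have "\<beta> (\<lambda>i. (v(j := x)) (\<sigma> (p + i))) = \<beta> ((\<lambda>i. v (\<sigma> (p + i)))(l' := x))" for x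
        by (rule arg_cong[where f = \<beta>]) (use 2 in \<open>auto simp: \<sigma>l\<close>)
      moreover have "linear (\<lambda>x. \<beta> ((\<lambda>i. v (\<sigma> (p + i)))(l' := x)))"
        using \<beta> 2 unfolding multilinear_form_def by blast
      ultimately show ?thesis
        by (simp add: linear_iff algebra_simps)
    qed
  qed
  then have "linear (\<lambda>x. \<Sum>\<sigma> | \<sigma> permutes {..<p + q}.
      of_int (sign \<sigma>) * \<alpha> (\<lambda>i. (v(j := x)) (\<sigma> i)) * \<beta> (\<lambda>i. (v(j := x)) (\<sigma> (p + i))))"
    by (intro linear_compose_sum) auto
  then show "linear (\<lambda>x. wedge p q \<alpha> \<beta> (v(j := x)))"
    unfolding wedge_def by (simp add: linear_iff add_divide_distrib)
qed

text \<open>Vanishing of the interior product with \<open>x\<close>, demanded in every slot so that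
  it also makes sense for forms not known to be alternating.\<close>

definition annihilated_by :: "'a \<Rightarrow> nat \<Rightarrow> ((nat \<Rightarrow> 'a) \<Rightarrow> real) \<Rightarrow> bool" where
  "annihilated_by x k \<alpha> \<longleftrightarrow> (\<forall>v. (\<exists>i<k. v i = x) \<longrightarrow> \<alpha> v = 0)"

lemma annihilated_by_wedge:
  assumes \<alpha>: "annihilated_by x p \<alpha>" and \<beta>: "annihilated_by x q \<beta>"
  shows "annihilated_by x (p + q) (wedge p q \<alpha> \<beta>)"
  unfolding annihilated_by_def
proof (intro allI impI)
  fix v :: "nat \<Rightarrow> 'a" assume "\<exists>j<p + q. v j = x"
  then obtain j where j: "j < p + q" "v j = x" by blast
  have "\<alpha> (\<lambda>i. v (\<sigma> i)) = 0 \<or> \<beta> (\<lambda>i. v (\<sigma> (p + i))) = 0" if \<sigma>: "\<sigma> permutes {..<p + q}" for \<sigma>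
  proof -
    define l where "l = inv \<sigma> j"
    have l: "\<sigma> l = j" unfolding l_def using \<sigma> by (rule permutes_inverses)
    have "l < p + q" using permutes_in_image[OF \<sigma>, of l] j l by simp
    then consider "l < p" | l' where "l = p + l'" "l' < q"
      by (metis add_less_cancel_left le_Suc_ex not_less)
    then show ?thesis
      using \<alpha> \<beta> j l unfolding annihilated_by_def by cases auto
  qed
  then show "wedge p q \<alpha> \<beta> v = 0"
    unfolding wedge_def by (force intro!: sum.neutral)
qed

lemma multilinear_two_form_power:
  assumes "bilinear \<omega>"
  shows "multilinear_form (2 * k) (two_form_power \<omega> k)"
proof (induction k)
  case 0
  then show ?case by (simp add: multilinear_form_def)
next
  case (Suc k)
  have "multilinear_form 2 (two_form \<omega>)"
    using assms by (auto simp: multilinear_form_def two_form_def bilinear_def less_2_cases_iff)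
  from multilinear_form_wedge[OF this Suc] show ?case by simp
qed

lemma annihilated_by_two_form_power:
  assumes "\<And>y. \<omega> x y = 0" "\<And>y. \<omega> y x = 0"
  shows "annihilated_by x (2 * k) (two_form_power \<omega> k)"
proof (induction k)
  case 0
  then show ?case by (simp add: annihilated_by_def)
next
  case (Suc k)
  have "annihilated_by x 2 (two_form \<omega>)"
    using assms by (auto simp: annihilated_by_def two_form_def less_2_cases_iff)
  from annihilated_by_wedge[OF this Suc] show ?case by simp
qed

text \<open>In dimension \<open>N\<close> the vectors \<open>x, v 0, ..., v (N - 1)\<close> are
  dependent, and as \<open>x\<close> is nonzero some \<open>v j\<close> lies in the span of
  \<open>x\<close> and the other entries. Expanding slot \<open>j\<close> leaves only terms with an
  entry \<open>x\<close> or a repeated entry.\<close>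

lemma multilinear_form_top_eq_0:
  fixes \<alpha> :: "(nat \<Rightarrow> 'a::real_vector) \<Rightarrow> real"
  assumes dim: "dim (UNIV :: 'a set) = N" "0 < N"
    and lin: "multilinear_form N \<alpha>"
    and alt: "\<And>v i j. v i = v j \<Longrightarrow> i < N \<Longrightarrow> j < N \<Longrightarrow> i \<noteq> j \<Longrightarrow> \<alpha> v = 0"
    and ann: "annihilated_by x N \<alpha>" and "x \<noteq> 0"
  shows "\<alpha> v = 0"
proof -
  have "\<exists>j<N. v j \<in> span (insert x (v ` ({..<N} - {j})))"
  proof (rule ccontr)
    assume contr: "\<not> ?thesis"
    have "independent (insert x (v ` {..<k})) \<and> card (insert x (v ` {..<k})) = k + 1" if "k \<le> N" for k
      using that
    proof (induction k)
      case 0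
      then show ?case using \<open>x \<noteq> 0\<close> by simp
    next
      case (Suc k)
      have "v k \<notin> span (insert x (v ` ({..<N} - {k})))" using contr Suc by auto
      moreover have "insert x (v ` {..<k}) \<subseteq> insert x (v ` ({..<N} - {k}))" using Suc by auto
      ultimately have *: "v k \<notin> span (insert x (v ` {..<k}))" using span_mono by blast
      moreover have "insert x (v ` {..<Suc k}) = insert (v k) (insert x (v ` {..<k}))"
        by (simp add: lessThan_Suc insert_commute)
      moreover have "v k \<notin> insert x (v ` {..<k})" using * by (metis span_base)
      ultimately show ?case using Suc.IH Suc.prems by (simp add: independent_insertI)
    qed
    then have S: "independent (insert x (v ` {..<N}))" "card (insert x (v ` {..<N})) = N + 1" by auto
    obtain B :: "'a set" where B: "UNIV \<subseteq> span B" "card B = N" using basis_exists dim(1) by metis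
    \<comment> \<open>An infinite basis would have cardinality 0, so a positive \<open>dim\<close>
      forces a finite one.\<close>
    then have "finite B" using dim(2) card_ge_0_finite by metis
    from independent_span_bound[OF this S(1)] B S(2) show False by auto
  qed
  then obtain j where j: "j < N" "v j \<in> span (insert x (v ` ({..<N} - {j})))" by blast
  have "linear (\<lambda>y. \<alpha> (v(j := y)))" using lin j by (simp add: multilinear_form_def)
  moreover have "\<alpha> (v(j := y)) = 0" if y: "y \<in> insert x (v ` ({..<N} - {j}))" for y
  proof (cases "y = x")
    case True
    then show ?thesis using ann j unfolding annihilated_by_def by (metis fun_upd_same)
  next
    case False
    then obtain i where "i < N" "i \<noteq> j" "y = v i" using y by auto
    then show ?thesis using j by (intro alt[of _ i j]) auto
  qed
  ultimately have "\<alpha> (v(j := v j)) = 0"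
    using j(2) by (rule linear_eq_0_on_span)
  then show ?thesis by simp
qed

text \<open>Such an \<open>x\<close> annihilates both factors of the wedge, whose degree is the full
  dimension.\<close>

lemma maximal_rank_imp_nondegenerate:
  fixes br :: "'a::real_vector \<Rightarrow> 'a \<Rightarrow> 'a"
  assumes "dim (UNIV :: 'a set) = 2 * m + 1" and "linear \<eta>" and "bilinear (ce_d1 br \<eta>)"
    and "maximal_rank br m \<eta>"
    and "\<eta> x = 0" "\<And>y. ce_d1 br \<eta> x y = 0" "\<And>y. ce_d1 br \<eta> y x = 0"
  shows "x = 0"
proof (rule ccontr)
  assume "x \<noteq> 0"
  have 1: "multilinear_form 1 (one_form \<eta>)" "annihilated_by x 1 (one_form \<eta>)"
    using assms by (auto simp: multilinear_form_def annihilated_by_def one_form_def)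
  note m = multilinear_form_wedge[OF 1(1) multilinear_two_form_power[OF assms(3), of m]]
  have a: "annihilated_by x (1 + 2 * m) (wedge 1 (2 * m) (one_form \<eta>) (two_form_power (ce_d1 br \<eta>) m))"
    using assms by (intro annihilated_by_wedge[OF 1(2)] annihilated_by_two_form_power)
  have "wedge 1 (2 * m) (one_form \<eta>) (two_form_power (ce_d1 br \<eta>) m) v = 0" for v
    by (rule multilinear_form_top_eq_0[OF _ _ m _ a \<open>x \<noteq> 0\<close>])
      (auto simp: assms(1) intro: wedge_repeated)
  then show False using assms(4) unfolding maximal_rank_def by (auto simp: fun_eq_iff)
qed

text \<open>Because \<eta> vanishes on all entries but \<open>v 0\<close>, only permutations fixing
  0 contribute. Their sign occurs twice, so each contributes the same positive value of the power of
  d\<eta>.\<close>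

lemma maximal_rank_of_symplectic_basis:
  assumes skew: "\<And>x y. br x y = - br y x" and "linear \<eta>"
    and "\<eta> (v 0) = 1" "\<And>i. 0 < i \<Longrightarrow> i \<le> 2 * m \<Longrightarrow> \<eta> (v i) = 0"
    and "\<And>i. i < m \<Longrightarrow> 0 < ce_d1 br \<eta> (v (2 * i + 1)) (v (2 * i + 2))"
    and "\<And>a b. a < 2 * m \<Longrightarrow> b < 2 * m \<Longrightarrow> a div 2 \<noteq> b div 2 \<Longrightarrow> ce_d1 br \<eta> (v (a + 1)) (v (b + 1)) = 0"
  shows "maximal_rank br m \<eta>"
proof -
  let ?F = "two_form_power (ce_d1 br \<eta>) m" and ?P = "{\<sigma>. \<sigma> permutes {..<1 + 2 * m}}"
  define t where "t \<sigma> = of_int (sign \<sigma>) * one_form \<eta> (\<lambda>i. v (\<sigma> i)) * ?F (\<lambda>i. v (\<sigma> (1 + i)))" for \<sigma>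
  have "ce_d1 br \<eta> x y = - ce_d1 br \<eta> y x" for x y
    using linear_neg[OF \<open>linear \<eta>\<close>] by (simp add: ce_d1_def skew[of x])
  then have F: "0 < ?F (\<lambda>i. v (1 + i))"
    by (rule two_form_power_pos) (use assms(5,6) in simp_all)
  have t: "t \<sigma> = (if \<sigma> 0 = 0 then ?F (\<lambda>i. v (1 + i)) else 0)" if "\<sigma> \<in> ?P" for \<sigma>
  proof (cases "\<sigma> 0 = 0")
    case True
    have "\<sigma> x = x" if "x \<in> {..<1 + 2 * m} - {1..<1 + 2 * m}" for x
    proof -
      have "x = 0" using that by auto
      with True show ?thesis by simp
    qed
    with \<open>\<sigma> \<in> ?P\<close> have \<sigma>: "\<sigma> permutes {1..<1 + 2 * m}"
      using permutes_superset by blast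
    have "?F (\<lambda>i. v (\<sigma> (1 + i))) = of_int (sign \<sigma>) * ?F (\<lambda>i. v (1 + i))"
      by (rule alternating_shift_permute[where F = ?F, OF two_form_power_permute \<sigma>])
    then show ?thesis
      using True by (simp add: t_def one_form_def assms(3) sign_def)
  next
    case False
    have "\<sigma> 0 < 1 + 2 * m" using permutes_in_image[of \<sigma> _ 0] \<open>\<sigma> \<in> ?P\<close> by fastforce
    then show ?thesis using False assms(4)[of "\<sigma> 0"] by (simp add: t_def one_form_def)
  qed
  have "0 < sum t ?P"
    by (rule sum_pos2[of _ id]) (use F t in \<open>auto simp: finite_permutations permutes_id\<close>)
  then have "wedge 1 (2 * m) (one_form \<eta>) ?F v \<noteq> 0"
    unfolding t_def by (simp add: wedge_def)
  then show ?thesis unfolding maximal_rank_def by auto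
qed

section \<open>Traces with respect to an inner product\<close>

locale finite_inner_product =
  fixes g :: "'a::real_vector \<Rightarrow> 'a \<Rightarrow> real"
  assumes is_inner: "is_inner_product g"
    and finite_dim: "\<exists>B :: 'a set. finite B \<and> span B = UNIV"
begin

lemma bilinear_g: "bilinear g" and g_commute: "g x y = g y x" and g_pos: "x \<noteq> 0 \<Longrightarrow> 0 < g x x"
  using is_inner unfolding is_inner_product_def by blast+

lemmas g_simps =
  bilinear_ladd[OF bilinear_g] bilinear_radd[OF bilinear_g]
  bilinear_lmul[OF bilinear_g] bilinear_rmul[OF bilinear_g]
  bilinear_lneg[OF bilinear_g] bilinear_rneg[OF bilinear_g]
  bilinear_lsub[OF bilinear_g] bilinear_rsub[OF bilinear_g]
  bilinear_lzero[OF bilinear_g] bilinear_rzero[OF bilinear_g]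

lemma linear_g_left: "linear (\<lambda>x. g x y)" and linear_g_right: "linear (g x)"
  using bilinear_g unfolding bilinear_def by blast+

lemma g_sum_left: "g (\<Sum>i\<in>I. f i) y = (\<Sum>i\<in>I. g (f i) y)"
  and g_sum_right: "g y (\<Sum>i\<in>I. f i) = (\<Sum>i\<in>I. g y (f i))"
  using linear_sum[OF linear_g_left] linear_sum[OF linear_g_right] by auto

lemma g_self_nonneg: "0 \<le> g x x"
  using g_pos[of x] by (cases "x = 0") (auto simp: g_simps)

lemma g_self_eq_0: "g x x = 0 \<longleftrightarrow> x = 0"
  using g_pos[of x] bilinear_lzero[OF bilinear_g] by (metis less_irrefl)

definition orthonormal :: "'a set \<Rightarrow> bool" where
  "orthonormal E \<longleftrightarrow> (\<forall>e\<in>E. \<forall>f\<in>E. g e f = (if e = f then 1 else 0))"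

lemma orthonormal_sum_left:
  assumes "orthonormal E" "finite S" "S \<subseteq> E" "f \<in> S"
  shows "g (\<Sum>e\<in>S. c e *\<^sub>R e) f = c f"
proof -
  have "g (\<Sum>e\<in>S. c e *\<^sub>R e) f = (\<Sum>e\<in>S. if e = f then c e else 0)"
    unfolding g_sum_left by (rule sum.cong) (use assms in \<open>auto simp: g_simps orthonormal_def subset_iff\<close>)
  with assms show ?thesis by simp
qed

lemma orthonormal_imp_independent:
  assumes "orthonormal E"
  shows "independent E"
proof (subst independent_explicit_finite_subsets, intro allI impI ballI)
  fix S u v assume S: "S \<subseteq> E" "finite S" "(\<Sum>v\<in>S. u v *\<^sub>R v) = 0" "v \<in> S"
  show "u v = 0"
    using orthonormal_sum_left[OF assms S(2,1,4), of u] S(3) by (simp add: g_simps)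
qed

lemma orthonormal_bounded: "\<exists>N. \<forall>E. orthonormal E \<longrightarrow> finite E \<and> card E \<le> N"
proof -
  obtain B where "finite B" "span B = (UNIV :: 'a set)" using finite_dim by blast
  then show ?thesis
    using independent_span_bound[OF _ orthonormal_imp_independent, of B] by (metis subset_UNIV)
qed

text \<open>A largest orthonormal set between \<open>E\<close> and \<open>V\<close> spans
  \<open>V\<close>: a vector of \<open>V\<close> outside its span would enlarge it by one
  Gram-Schmidt step.\<close>

lemma orthonormal_extend:
  assumes "orthonormal E" "E \<subseteq> V" "subspace V"
  obtains F where "E \<subseteq> F" "orthonormal F" "span F = V"
proof -
  let ?P = "\<lambda>F. E \<subseteq> F \<and> F \<subseteq> V \<and> orthonormal F"
  obtain N where N: "finite F" "card F \<le> N" if "orthonormal F" for F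
    using orthonormal_bounded by blast
  have "\<exists>F. ?P F \<and> (\<forall>F'. ?P F' \<longrightarrow> card F' \<le> card F)"
    by (rule ex_has_greatest_nat[of ?P E card "Suc N"]) (use assms N in \<open>auto simp: less_Suc_eq_le\<close>)
  then obtain F where F: "?P F" and max: "\<And>F'. ?P F' \<Longrightarrow> card F' \<le> card F" by blast
  have fin: "finite F" using F N by blast
  have "x \<in> span F" if "x \<in> V" for x
  proof (rule ccontr)
    assume x: "x \<notin> span F"
    define y where "y = x - (\<Sum>f\<in>F. g x f *\<^sub>R f)"
    have sp: "(\<Sum>f\<in>F. g x f *\<^sub>R f) \<in> span F" by (intro span_sum span_scale span_base)
    then have "y \<noteq> 0" using x unfolding y_def by auto
    have "span F \<subseteq> V" using F \<open>subspace V\<close> by (simp add: span_minimal)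
    then have "y \<in> V" unfolding y_def using sp that \<open>subspace V\<close> by (intro subspace_diff) auto
    have yf: "g y f = 0" if "f \<in> F" for f
      using orthonormal_sum_left[of F F f "g x"] F fin that unfolding y_def by (simp add: g_simps)
    define e where "e = (1 / sqrt (g y y)) *\<^sub>R y"
    have "g e e = 1" using g_pos[OF \<open>y \<noteq> 0\<close>] by (simp add: e_def g_simps)
    moreover have ef: "g e f = 0" "g f e = 0" if "f \<in> F" for f
      using yf[OF that] g_commute[of f y] by (simp_all add: e_def g_simps)
    ultimately have "orthonormal (insert e F)" "e \<notin> F"
      using F unfolding orthonormal_def by auto
    moreover have "e \<in> V" unfolding e_def using \<open>y \<in> V\<close> \<open>subspace V\<close> by (rule subspace_scale[rotated])
    ultimately show False using max[of "insert e F"] F fin by auto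
  qed
  then have "span F = V" using F \<open>subspace V\<close> by (intro equalityI span_minimal) auto
  with F show thesis using that by blast
qed

section \<open>Orthonormal bases, traces and nilpotent maps\<close>

definition orthonormal_basis :: "'a set \<Rightarrow> bool" where
  "orthonormal_basis E \<longleftrightarrow> orthonormal E \<and> span E = UNIV"

lemma orthonormal_basis_exists: obtains E where "orthonormal_basis E"
proof -
  have "orthonormal {}" by (simp add: orthonormal_def)
  then obtain F where "orthonormal F" "span F = UNIV"
    using orthonormal_extend[of "{}" UNIV] by auto
  then show thesis using that by (simp add: orthonormal_basis_def)
qed

lemma finite_orthonormal_basis: "orthonormal_basis E \<Longrightarrow> finite E"
  using orthonormal_bounded unfolding orthonormal_basis_def by blast

lemma orthonormal_expansion:
  assumes "orthonormal_basis E"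
  shows "(\<Sum>e\<in>E. g x e *\<^sub>R e) = x"
proof -
  define y where "y = x - (\<Sum>f\<in>E. g x f *\<^sub>R f)"
  have "g y f = 0" if "f \<in> E" for f
    using orthonormal_sum_left[of E E f "g x"] finite_orthonormal_basis[OF assms] assms that
    unfolding y_def orthonormal_basis_def by (simp add: g_simps)
  then have "g y y = 0"
    using linear_eq_0_on_span[OF linear_g_right, of E y y] assms
    unfolding orthonormal_basis_def by auto
  then show ?thesis by (simp add: g_self_eq_0 y_def)
qed

lemma g_expand:
  assumes "orthonormal_basis E" "linear A"
  shows "g (A x) y = (\<Sum>e\<in>E. g x e * g (A e) y)"
proof -
  have "g (A x) y = g (A (\<Sum>e\<in>E. g x e *\<^sub>R e)) y"
    by (simp add: orthonormal_expansion[OF assms(1)])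
  then show ?thesis
    by (simp add: linear_sum[OF assms(2)] linear_cmul[OF assms(2)] g_sum_left g_simps)
qed

text \<open>Expanding in both bases turns either trace into the same double sum of
  \<open>g e f * g (A e) f\<close>.\<close>

lemma trace_basis_independent:
  assumes E: "orthonormal_basis E" and F: "orthonormal_basis F" and A: "linear A"
  shows "(\<Sum>e\<in>E. g (A e) e) = (\<Sum>f\<in>F. g (A f) f)"
proof -
  have "(\<Sum>e\<in>E. g (A e) e) = (\<Sum>e\<in>E. \<Sum>f\<in>F. g e f * g (A e) f)"
  proof (rule sum.cong[OF refl])
    fix e
    have "g e (A e) = (\<Sum>f\<in>F. g e f * g f (A e))"
      using g_expand[OF F linear_id, of e "A e"] by simp
    then show "g (A e) e = (\<Sum>f\<in>F. g e f * g (A e) f)"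
      by (simp only: g_commute[of "A e"])
  qed
  also have "\<dots> = (\<Sum>f\<in>F. \<Sum>e\<in>E. g f e * g (A e) f)"
    by (subst sum.swap, intro sum.cong refl) (simp only: g_commute)
  also have "\<dots> = (\<Sum>f\<in>F. g (A f) f)"
    by (intro sum.cong refl g_expand[OF E A, symmetric])
  finally show ?thesis .
qed

lemma trace_commute:
  assumes E: "orthonormal_basis E" and A: "linear A" and C: "linear C"
  shows "(\<Sum>e\<in>E. g (A (C e)) e) = (\<Sum>e\<in>E. g (C (A e)) e)"
proof -
  have "(\<Sum>e\<in>E. g (A (C e)) e) = (\<Sum>e\<in>E. \<Sum>f\<in>E. g (C e) f * g (A f) e)"
    by (intro sum.cong refl g_expand[OF E A])
  also have "\<dots> = (\<Sum>f\<in>E. \<Sum>e\<in>E. g (A f) e * g (C e) f)"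
    by (subst sum.swap) (simp add: mult.commute)
  also have "\<dots> = (\<Sum>e\<in>E. g (C (A e)) e)"
    by (intro sum.cong refl g_expand[OF E C, symmetric])
  finally show ?thesis .
qed

text \<open>Take such a basis of \<open>A\<close>
  V\<open>, on which\<close>A\<open>has smaller nilpotency index, and extend it to\<close>V\<open>. A new basis vector\<close>e\<open>is orthogonal to\<close>A
  \<open>V\<close>, hence to \<open>A e\<close>.\<close>

lemma nilpotent_orthonormal_flag:
  assumes A: "linear A" and "subspace V" "A ` V \<subseteq> V" "\<And>x. x \<in> V \<Longrightarrow> (A ^^ k) x = 0"
  shows "\<exists>E. orthonormal E \<and> span E = V \<and> (\<forall>e\<in>E. g (A e) e = 0)"
  using assms(2-4)
proof (induction k arbitrary: V)
  case 0
  then have "V = {0}" using subspace_0 by auto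
  then show ?case by (intro exI[of _ "{}"]) (auto simp: orthonormal_def)
next
  case (Suc k)
  have "(A ^^ k) x = 0" if "x \<in> A ` V" for x
    using that Suc.prems(3) by (auto simp: funpow_swap1)
  then obtain E where E: "orthonormal E" "span E = A ` V" "\<And>e. e \<in> E \<Longrightarrow> g (A e) e = 0"
    using Suc.IH[of "A ` V"] Suc.prems linear_subspace_image[OF A] by (metis image_mono)
  have "E \<subseteq> V" using E(2) Suc.prems(2) span_superset by blast
  then obtain F where F: "E \<subseteq> F" "orthonormal F" "span F = V"
    using orthonormal_extend E(1) Suc.prems(1) by metis
  have "g (A e) e = 0" if "e \<in> F" for e
  proof (cases "e \<in> E")
    case False
    have "A e \<in> span E" using that F(3) E(2) span_base by blast
    moreover have "g f e = 0" if "f \<in> E" for f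
      using F that \<open>e \<in> F\<close> False unfolding orthonormal_def by auto
    ultimately show ?thesis using linear_eq_0_on_span[OF linear_g_left[of e]] by blast
  qed (rule E(3))
  with F show ?case by blast
qed

lemma trace_nilpotent:
  assumes E: "orthonormal_basis E" and A: "linear A" and "\<And>x. (A ^^ k) x = 0"
  shows "(\<Sum>e\<in>E. g (A e) e) = 0"
proof -
  obtain F where "orthonormal F" "span F = UNIV" "\<And>e. e \<in> F \<Longrightarrow> g (A e) e = 0"
    using nilpotent_orthonormal_flag[OF A, of UNIV k] assms(3) by auto
  then show ?thesis
    using trace_basis_independent[OF E _ A, of F] by (simp add: orthonormal_basis_def)
qed

text \<open>The exponent can be lowered as long as it is at least 2: skewness moves one
  \<open>A\<close> across and shows that the squared norm of a power is a product with the next,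
  vanishing power.\<close>

lemma skew_nilpotent_eq_0:
  assumes skew: "\<And>x y. g (A x) y = - g x (A y)" and "\<And>x. (A ^^ Suc k) x = 0"
  shows "A x = 0"
  using assms(2)
proof (induction k)
  case 0
  then show ?case by simp
next
  case (Suc k)
  have "(A ^^ Suc k) y = 0" for y
    using skew[of "(A ^^ Suc k) y" "(A ^^ k) y"] Suc.prems[of y] by (simp add: g_simps g_self_eq_0)
  then show ?case by (rule Suc.IH)
qed

end

section \<open>Nilpotent anti-quasi-Sasakian algebras are two-step\<close>

locale nilpotent_aqs =
  anti_quasi_sasakian br m \<phi> \<xi> \<eta> g + lie_algebra UNIV br
  for br :: "'a::real_vector \<Rightarrow> 'a \<Rightarrow> 'a"
    and m :: nat and \<phi> :: "'a \<Rightarrow> 'a" and \<xi> :: 'a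
    and \<eta> :: "'a \<Rightarrow> real" and g :: "'a \<Rightarrow> 'a \<Rightarrow> real" +
  assumes nilpotent: "lie_nilpotent UNIV br"
begin

sublocale finite_inner_product g
proof
  obtain B :: "'a set" where B: "UNIV \<subseteq> span B" "card B = dim (UNIV :: 'a set)"
    using basis_exists by metis
  \<comment> \<open>The odd \<open>dim\<close> is nonzero, which again excludes an infinite
    basis.\<close>
  then have "finite B" using dim_odd by (intro card_ge_0_finite) simp
  then show "\<exists>B :: 'a set. finite B \<and> span B = UNIV" using B by blast
qed (rule inner_product)

lemma bilinear_br: "bilinear br"
  unfolding bilinear_def linear_iff
  by (simp add: bracket_add_left bracket_add_right bracket_scale_left bracket_scale_right)

lemmas br_simps =
  bilinear_ladd[OF bilinear_br] bilinear_radd[OF bilinear_br]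
  bilinear_lmul[OF bilinear_br] bilinear_rmul[OF bilinear_br]
  bilinear_lneg[OF bilinear_br] bilinear_rneg[OF bilinear_br]
  bilinear_lsub[OF bilinear_br] bilinear_rsub[OF bilinear_br]
  bilinear_lzero[OF bilinear_br] bilinear_rzero[OF bilinear_br]

lemmas phi_simps = linear_add[OF linear_phi] linear_cmul[OF linear_phi] linear_neg[OF linear_phi]
  linear_diff[OF linear_phi] linear_0[OF linear_phi]

lemmas eta_simps = linear_add[OF linear_eta] linear_cmul[OF linear_eta] linear_neg[OF linear_eta]
  linear_diff[OF linear_eta] linear_0[OF linear_eta]

lemma br_skew: "br x y = - br y x"
  using bracket_self[of "x + y"] bracket_self[of x] bracket_self[of y]
  by (simp add: br_simps add_eq_0_iff)

section \<open>Consequences of the structure equations; \<xi> is central\<close>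

lemma xi_nonzero: "\<xi> \<noteq> 0"
  using eta_xi eta_simps by auto

lemma phi_xi: "\<phi> \<xi> = 0"
proof -
  have *: "\<phi> (\<phi> \<xi>) = 0" by (simp add: phi_phi eta_xi)
  then have c: "\<phi> \<xi> = \<eta> (\<phi> \<xi>) *\<^sub>R \<xi>" using phi_phi[of "\<phi> \<xi>"] by (simp add: phi_simps)
  then have "\<phi> (\<phi> \<xi>) = \<eta> (\<phi> \<xi>) *\<^sub>R (\<eta> (\<phi> \<xi>) *\<^sub>R \<xi>)" by (metis phi_simps(2))
  then have "\<eta> (\<phi> \<xi>) = 0" using * xi_nonzero by simp
  with c show ?thesis by simp
qed

lemma eta_phi: "\<eta> (\<phi> x) = 0"
proof -
  have "\<phi> (\<phi> (\<phi> x)) = - \<phi> x" by (subst phi_phi) (simp add: phi_simps phi_xi)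
  then have "\<eta> (\<phi> x) *\<^sub>R \<xi> = 0" using phi_phi[of "\<phi> x"] by simp
  then show ?thesis using xi_nonzero by simp
qed

lemma g_xi: "g x \<xi> = \<eta> x" "g \<xi> x = \<eta> x"
  using compatible[of x \<xi>] g_commute[of \<xi> x] by (simp_all add: phi_xi eta_xi g_simps)

lemma g_phi: "g x (\<phi> y) = - g (\<phi> x) y"
  using compatible[of x "\<phi> y"] by (simp add: phi_phi eta_phi g_simps g_xi)

text \<open>In \<open>N_tensor\<close> the \<xi>-part of \<phi> applied twice to the bracket cancels
  the term with d\<eta>, so the only \<xi>-term left is the prescribed one.\<close>

lemma N_expanded:
  "br (\<phi> x) (\<phi> y) = br x y + \<phi> (br x (\<phi> y)) + \<phi> (br (\<phi> x) y) - (2 * \<eta> (br x y)) *\<^sub>R \<xi>"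
proof -
  have "- (2 * \<eta> (br x y)) *\<^sub>R \<xi> = - (\<eta> (br x y) *\<^sub>R \<xi>) - \<eta> (br x y) *\<^sub>R \<xi>"
    by (simp add: scaleR_add_left[symmetric] flip: scaleR_minus_left scaleR_diff_left)
  then show ?thesis
    using N_eq[of x y] unfolding N_tensor_def ce_d1_def phi_phi by (simp add: algebra_simps)
qed

text \<open>Anti-invariance of d\<eta>: after \<eta> is applied, the prescribed term subtracts twice
  the value that the first term contributes.\<close>

lemma eta_br_phi_phi: "\<eta> (br (\<phi> x) (\<phi> y)) = - \<eta> (br x y)"
  by (subst N_expanded) (simp add: eta_simps eta_phi eta_xi)

lemma eta_br_xi: "\<eta> (br \<xi> y) = 0" "\<eta> (br y \<xi>) = 0"
  using eta_br_phi_phi[of \<xi> y] eta_br_phi_phi[of y \<xi>] by (simp_all add: phi_xi br_simps eta_simps)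

lemma closed:
  "g (br x y) (\<phi> z) + g (br y z) (\<phi> x) + g (br z x) (\<phi> y) = 0"
  using fundamental_form_closed[of x y z] unfolding ce_d2_def fundamental_form_def by simp

lemma phi_br_xi: "\<phi> (br x \<xi>) = br (\<phi> x) \<xi>"
proof -
  have "br x \<xi> = - \<phi> (br (\<phi> x) \<xi>)"
    using N_expanded[of x \<xi>] by (simp add: phi_xi br_simps eta_br_xi phi_simps eq_neg_iff_add_eq_0)
  then have "\<phi> (br x \<xi>) = - \<phi> (\<phi> (br (\<phi> x) \<xi>))" by (simp add: phi_simps)
  then show ?thesis by (simp add: phi_phi eta_br_xi)
qed

text \<open>Since \<Phi> annihilates \<xi>, closedness with \<xi> inserted says that \<Phi> is
  invariant under ad \<xi>. As ad \<xi> commutes with \<phi>, the invariance passes to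
  \<open>g\<close>.\<close>

lemma br_xi_skew: "g (br \<xi> x) y = - g x (br \<xi> y)"
proof -
  have "y = - \<phi> (\<phi> y) + \<eta> y *\<^sub>R \<xi>" by (simp add: phi_phi)
  then have "g (br \<xi> x) y = g (br \<xi> x) (- \<phi> (\<phi> y) + \<eta> y *\<^sub>R \<xi>)" by simp
  also have "\<dots> = - g (br \<xi> x) (\<phi> (\<phi> y))" by (simp add: g_simps g_xi eta_br_xi)
  also have "\<dots> = g (br (\<phi> y) \<xi>) (\<phi> x)"
    using closed[of \<xi> x "\<phi> y"] by (simp add: phi_xi g_simps)
  also have "\<dots> = g (br y \<xi>) x"
    by (simp add: phi_br_xi[symmetric] compatible eta_br_xi)
  finally show ?thesis by (simp add: br_skew[of y] g_simps g_commute)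
qed

lemma br_funpow_in_lower_central_series:
  "(br x ^^ k) y \<in> lower_central_series UNIV br k"
  by (induction k) (auto intro!: span_base)

lemma ad_nilpotent: "\<exists>k. \<forall>x y. (br x ^^ k) y = 0"
  using nilpotent br_funpow_in_lower_central_series unfolding lie_nilpotent_def by blast

lemma xi_central: "br \<xi> x = 0" "br x \<xi> = 0"
proof -
  obtain k where "\<And>x y. (br x ^^ k) y = 0" using ad_nilpotent by blast
  then have "(br \<xi> ^^ Suc k) x = 0" for x by (simp add: br_simps)
  then show "br \<xi> x = 0" using skew_nilpotent_eq_0[of "br \<xi>"] br_xi_skew by blast
  then show "br x \<xi> = 0" by (simp add: br_skew[of x])
qed

section \<open>The Kaehler quotient by \<xi> and its commutativity\<close>

text \<open>The bracket of the quotient by \<open>\<real>\<xi>\<close>, lifted to \<open>ker \<eta>\<close> and extended by zero along \<open>\<xi>\<close>.\<close>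

definition hbr :: "'a \<Rightarrow> 'a \<Rightarrow> 'a" where
  "hbr x y = br x y - \<eta> (br x y) *\<^sub>R \<xi>"

lemma bilinear_hbr: "bilinear hbr"
  unfolding bilinear_def linear_iff hbr_def by (simp add: br_simps eta_simps algebra_simps)

lemmas hbr_simps =
  bilinear_ladd[OF bilinear_hbr] bilinear_radd[OF bilinear_hbr]
  bilinear_lmul[OF bilinear_hbr] bilinear_rmul[OF bilinear_hbr]
  bilinear_lneg[OF bilinear_hbr] bilinear_rneg[OF bilinear_hbr]
  bilinear_lsub[OF bilinear_hbr] bilinear_rsub[OF bilinear_hbr]
  bilinear_lzero[OF bilinear_hbr] bilinear_rzero[OF bilinear_hbr]

lemma linear_hbr: "linear (hbr x)"
  using bilinear_hbr by (simp add: bilinear_def)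

lemma hbr_skew: "hbr x y = - hbr y x"
  unfolding hbr_def by (simp add: br_skew[of x y] eta_simps)

lemma hbr_xi: "hbr \<xi> x = 0" "hbr x \<xi> = 0"
  by (simp_all add: hbr_def xi_central eta_simps)

lemma eta_hbr: "\<eta> (hbr x y) = 0"
  by (simp add: hbr_def eta_simps eta_xi)

lemma phi_phi_hbr: "\<phi> (\<phi> (hbr x y)) = - hbr x y"
  by (simp add: phi_phi eta_hbr)

text \<open>The \<xi>-valued defect of integrability disappears modulo \<xi>: \<phi> is an
  integrable complex structure on the quotient. Together with \<open>hbr_closed\<close> this is the
  Kaehler property.\<close>

lemma hbr_phi_phi: "hbr (\<phi> x) (\<phi> y) = hbr x y + \<phi> (hbr x (\<phi> y)) + \<phi> (hbr (\<phi> x) y)"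
  unfolding hbr_def
  by (subst N_expanded, simp add: eta_br_phi_phi)
    (simp add: phi_simps phi_xi algebra_simps flip: scaleR_add_left)

lemma br_hbr: "br x (hbr y z) = br x (br y z)"
  by (simp add: hbr_def br_simps xi_central)

lemma hbr_jacobi: "hbr x (hbr y z) + hbr y (hbr z x) + hbr z (hbr x y) = 0"
proof -
  let ?p = "\<lambda>v. v - \<eta> v *\<^sub>R \<xi>"
  have "hbr x (hbr y z) + hbr y (hbr z x) + hbr z (hbr x y) =
      ?p (br x (br y z) + br y (br z x) + br z (br x y))"
    unfolding hbr_def[of _ "hbr _ _"] br_hbr by (simp add: eta_simps algebra_simps)
  then show ?thesis by (simp add: jacobi eta_simps)
qed

lemma hbr_closed:
  "g (hbr x y) (\<phi> z) + g (hbr y z) (\<phi> x) + g (hbr z x) (\<phi> y) = 0"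
  using closed[of x y z] by (simp add: hbr_def g_simps g_xi eta_phi)

lemma hbr_nilpotent: "\<exists>k. \<forall>x y. (hbr x ^^ k) y = 0"
proof -
  \<comment> \<open>The formula is false for the zeroth power, the identity, which does not project
    along \<xi>; hence the successor.\<close>
  have *: "(hbr x ^^ Suc k) y = (br x ^^ Suc k) y - \<eta> ((br x ^^ Suc k) y) *\<^sub>R \<xi>" for x y k
    by (induction k) (simp_all add: hbr_def br_simps xi_central)
  obtain k where "\<And>x y. (br x ^^ k) y = 0" using ad_nilpotent by blast
  then have "(hbr x ^^ Suc k) y = 0" for x y unfolding * by (simp add: br_simps eta_simps)
  then show ?thesis by blast
qed

lemma trace_hbr:
  assumes "orthonormal_basis E"
  shows "(\<Sum>e\<in>E. g (hbr x e) e) = 0"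
proof -
  obtain k where "\<And>x y. (hbr x ^^ k) y = 0" using hbr_nilpotent by blast
  then show ?thesis using trace_nilpotent[OF assms linear_hbr] by blast
qed

text \<open>Contracting \<open>d\<Phi> = 0\<close> turns this sum into traces of adjoint maps, which vanish since a
  nilpotent algebra is unimodular.\<close>

lemma sum_hbr_phi:
  assumes E: "orthonormal_basis E"
  shows "(\<Sum>e\<in>E. hbr e (\<phi> e)) = 0"
proof -
  define T where "T = (\<Sum>e\<in>E. hbr e (\<phi> e))"
  have tr: "(\<Sum>e\<in>E. g (hbr (\<phi> e) x) (\<phi> e)) = 0" for x
  proof -
    \<comment> \<open>Cyclicity of the trace turns \<phi> \<circ> ad \<open>x\<close> \<circ> \<phi>
      into ad \<open>x\<close> composed with the square of \<phi>, which is - ad \<open>x\<close>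
      because the bracket kills \<xi>.\<close>
    have "(\<Sum>e\<in>E. g (\<phi> (hbr x (\<phi> e))) e) = (\<Sum>e\<in>E. g (hbr x (\<phi> (\<phi> e))) e)"
      using trace_commute[OF E linear_phi linear_compose[OF linear_phi linear_hbr]] by simp
    also have "\<dots> = - (\<Sum>e\<in>E. g (hbr x e) e)"
      by (simp add: phi_phi hbr_simps hbr_xi g_simps sum_negf)
    also have "\<dots> = 0" by (simp add: trace_hbr[OF E])
    finally show ?thesis
      by (simp add: hbr_skew[of _ x] phi_simps g_simps g_phi sum_negf)
  qed
  have "g (hbr e (\<phi> e)) (\<phi> x) = g (hbr x e) e - g (hbr (\<phi> e) x) (\<phi> e)" for e x
    using hbr_closed[of e "\<phi> e" x] by (simp add: phi_phi g_simps g_xi eta_hbr)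
  then have "g T (\<phi> x) = 0" for x
    unfolding T_def g_sum_left by (simp add: sum_subtractf trace_hbr[OF E] tr)
  \<comment> \<open>\<open>T\<close> lies in ker \<eta>, hence in the image of \<phi>, to which it
    has just been shown to be orthogonal.\<close>
  moreover have "\<phi> (\<phi> T) = - T"
    unfolding T_def by (simp add: phi_phi linear_sum[OF linear_eta] eta_hbr)
  ultimately have "g T (- T) = 0" by metis
  then show ?thesis by (simp add: g_simps g_self_eq_0 T_def)
qed

text \<open>The key step: for central \<open>z\<close> the derivation \<open>D = [\<phi> z, -]\<close> commutes with \<open>\<phi>\<close> and
  \<open>d\<Phi> = 0\<close> expresses \<open>g([x, y], z)\<close> through \<open>D\<close>. Applying \<open>D\<close> to the vanishing sum of the
  \<open>[e, \<phi> e]\<close> and pairing with \<open>z\<close> gives \<open>- 2 (tr D\<^sup>2 + \<bar>D\<bar>\<^sup>2)\<close>, so \<open>D = 0\<close> as \<open>D\<close> is nilpotent.\<close>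

lemma hbr_orthogonal_center:
  assumes central: "\<And>y. hbr z y = 0"
  shows "g (hbr x y) z = 0"
proof -
  define D where "D = hbr (\<phi> z)"
  have linear_D: "linear D" unfolding D_def by (rule linear_hbr)
  have D_phi: "D (\<phi> y) = \<phi> (D y)" for y
    using hbr_phi_phi[of z y] by (simp add: D_def central phi_simps)
  have phi_phi_D: "\<phi> (\<phi> (D y)) = - D y" for y
    by (simp add: D_def phi_phi_hbr)
  have F: "g (hbr x y) z = g (D x) (\<phi> y) - g (D y) (\<phi> x)" for x y
    using hbr_closed[of "\<phi> z" x y] hbr_skew[of y "\<phi> z"]
    by (simp add: D_def phi_phi g_simps g_xi eta_hbr)
  have deriv: "D (hbr x y) = hbr (D x) y + hbr x (D y)" for x y
    using hbr_jacobi[of "\<phi> z" x y] hbr_skew[of y "\<phi> z"] hbr_skew[of y "hbr (\<phi> z) x"]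
    by (simp add: D_def hbr_simps algebra_simps)
  have summand: "g (D (hbr e (\<phi> e))) z = - 2 * (g (D (D e)) e + g (D e) (D e))" for e
  proof -
    have 1: "g (D (D e)) (\<phi> (\<phi> e)) = - g (D (D e)) e"
      by (simp add: phi_phi g_simps g_xi D_def eta_hbr)
    have 2: "g (\<phi> (D e)) (\<phi> (D e)) = g (D e) (D e)"
      by (simp add: compatible D_def eta_hbr)
    have 3: "g (\<phi> (D (D e))) (\<phi> e) = g (D (D e)) e"
      by (simp add: compatible D_def eta_hbr)
    show ?thesis
      unfolding deriv by (simp add: g_simps F D_phi phi_phi_D 1 2 3)
  qed
  obtain E where E: "orthonormal_basis E" by (rule orthonormal_basis_exists)
  obtain k where "\<And>x y. (hbr x ^^ k) y = 0" using hbr_nilpotent by blast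
  moreover have "((D \<circ> D) ^^ k) x = (D ^^ k) ((D ^^ k) x)" for x
    by (induction k) (simp_all add: funpow_swap1)
  ultimately have "((D \<circ> D) ^^ k) x = 0" for x by (simp add: D_def)
  then have trDD: "(\<Sum>e\<in>E. g (D (D e)) e) = 0"
    using trace_nilpotent[OF E linear_compose[OF linear_D linear_D], of k] by simp
  have "D (\<Sum>e\<in>E. hbr e (\<phi> e)) = 0"
    by (simp add: sum_hbr_phi[OF E] linear_0[OF linear_D])
  then have "(\<Sum>e\<in>E. g (D (hbr e (\<phi> e))) z) = 0"
    by (simp add: linear_sum[OF linear_D] g_sum_left[symmetric] g_simps)
  then have "(\<Sum>e\<in>E. g (D e) (D e)) = 0"
    by (simp add: summand sum.distrib sum_subtractf sum_negf trDD flip: sum_distrib_left)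
  then have "D e = 0" if "e \<in> E" for e
    using that finite_orthonormal_basis[OF E]
    by (simp add: sum_nonneg_eq_0_iff g_self_nonneg g_self_eq_0)
  then have "D x = 0" for x
    using linear_eq_0_on_span[OF linear_D, of E] E by (auto simp: orthonormal_basis_def)
  then show ?thesis by (simp add: F g_simps)
qed

text \<open>Descend along the lower central series. If the next term lies in the line of \<xi>, the
  current one is central modulo \<xi>; being also spanned by brackets, it is orthogonal to itself
  modulo \<xi>.\<close>

lemma hbr_eq_0: "hbr x y = 0"
proof -
  let ?C = "lower_central_series UNIV br" and ?p = "\<lambda>v. v - \<eta> v *\<^sub>R \<xi>"
  obtain K where "?C K = {0}" using nilpotent unfolding lie_nilpotent_def by blast
  \<comment> \<open>The descent has to start at an index of at least 1, as only those terms are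
    spanned by brackets.\<close>
  then have K: "?C (Suc K) = {0}" by (auto simp: br_simps)
  have "\<forall>v\<in>?C 1. ?p v = 0"
  proof (rule inc_induct[of 1 "Suc K"])
    show "\<forall>v\<in>?C (Suc K). ?p v = 0" unfolding K by (simp add: eta_simps)
  next
    fix n assume n: "1 \<le> n" and IH: "\<forall>v\<in>?C (Suc n). ?p v = 0"
    show "\<forall>v\<in>?C n. ?p v = 0"
    proof
      fix v assume v: "v \<in> ?C n"
      have "hbr x v = 0" for x
      proof -
        have "br x v \<in> ?C (Suc n)" using v by (auto intro: span_base)
        with IH show ?thesis by (auto simp: hbr_def)
      qed
      then have "hbr (?p v) y = 0" for y by (subst hbr_skew) (simp add: hbr_simps hbr_xi)
      then have *: "g (hbr x y) (?p v) = 0" for x y by (rule hbr_orthogonal_center)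
      obtain n' where n': "n = Suc n'" using n by (cases n) auto
      have lin: "linear (\<lambda>u. g (?p u) (?p v))"
        by (auto simp: linear_iff eta_simps g_simps algebra_simps)
      have "g (?p v) (?p v) = 0"
        by (rule linear_eq_0_on_span[OF lin _ v[unfolded n' lower_central_series.simps]])
          (use * in \<open>auto simp: hbr_def\<close>)
      then show "?p v = 0" by (simp add: g_self_eq_0)
    qed
  qed simp
  moreover have "br x y \<in> ?C 1" by (auto intro: span_base)
  ultimately show ?thesis by (simp add: hbr_def)
qed

lemma br_eq: "br x y = \<eta> (br x y) *\<^sub>R \<xi>"
  using hbr_eq_0[of x y] by (simp add: hbr_def)

end

section \<open>Normal form of the bracket\<close>

lemma heis_carrier_eq: "heis_carrier n = span ((\<lambda>i. Poly_Mapping.single i 1) ` {..4 * n})"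
proof -
  have "{..4 * n} = insert 0 {1..4 * n}" by auto
  then show ?thesis unfolding heis_carrier_def heis_xi_def heis_tau_def by (metis image_insert)
qed

lemma lookup_sum_single:
  fixes a :: "nat \<Rightarrow> real"
  shows "Poly_Mapping.lookup (\<Sum>i\<le>N. a i *\<^sub>R Poly_Mapping.single i (1::real)) j = (if j \<le> N then a j else 0)"
proof -
  have "Poly_Mapping.lookup (\<Sum>i\<le>N. a i *\<^sub>R Poly_Mapping.single i (1::real)) j =
      (\<Sum>i\<le>N. if i = j then a i else 0)"
    unfolding lookup_sum lookup_scaleR
    by (rule sum.cong) (auto simp: lookup_single when_def simp del: single_one)
  then show ?thesis by simp
qed

text \<open>Reduces an isomorphism to a coordinate system: functionals \<open>c\<close> dual to
  \<open>e\<close>, with joint injectivity of the \<open>c\<close> in the place of spanning by the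
  \<open>e\<close>.\<close>

lemma lie_isomorphic_heisI:
  fixes c :: "nat \<Rightarrow> 'a::real_vector \<Rightarrow> real"
  assumes lin: "\<And>i. linear (c i)"
    and dual: "\<And>i j. i \<le> 4 * n \<Longrightarrow> j \<le> 4 * n \<Longrightarrow> c i (e j) = (if i = j then 1 else 0)"
    and inj: "\<And>x. (\<And>i. i \<le> 4 * n \<Longrightarrow> c i x = 0) \<Longrightarrow> x = 0"
    and bracket: "\<And>x y. br x y = (\<Sum>r = 1..n. 2 * w r *
      (c r x * c (3 * n + r) y - c (3 * n + r) x * c r y
       + c (n + r) x * c (2 * n + r) y - c (2 * n + r) x * c (n + r) y)) *\<^sub>R e 0"
  shows "lie_isomorphic UNIV br (heis_carrier n) (heis_bracket n w)"
proof -
  let ?s = "\<lambda>i. Poly_Mapping.single i (1::real)"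
  define f where "f x = (\<Sum>i\<le>4 * n. c i x *\<^sub>R ?s i)" for x
  have lookup_f: "Poly_Mapping.lookup (f x) i = (if i \<le> 4 * n then c i x else 0)" for x i
    unfolding f_def by (rule lookup_sum_single)
  have linear_f: "linear f"
    unfolding linear_iff f_def
    by (simp add: linear_add[OF lin] linear_cmul[OF lin] scaleR_add_left sum.distrib scaleR_sum_right)
  have f_e: "f (e j) = ?s j" if "j \<le> 4 * n" for j
  proof (rule poly_mapping_eqI)
    fix k show "Poly_Mapping.lookup (f (e j)) k = Poly_Mapping.lookup (?s j) k"
      using that by (auto simp: lookup_f dual lookup_single when_def simp del: single_one)
  qed
  have "inj f"
    unfolding linear_injective_0[OF linear_f]
    by (metis inj lookup_f lookup_zero)
  moreover have "range f = heis_carrier n"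
  proof
    show "range f \<subseteq> heis_carrier n"
      unfolding heis_carrier_eq f_def by (intro image_subsetI span_sum span_scale span_base imageI)
    have "?s i \<in> range f" if "i \<le> 4 * n" for i using f_e[OF that] by (metis rangeI)
    then show "heis_carrier n \<subseteq> range f"
      unfolding heis_carrier_eq
      by (intro span_minimal linear_subspace_image[OF linear_f]) auto
  qed
  ultimately have "bij_betw f UNIV (heis_carrier n)" by (simp add: bij_betw_def)
  moreover have "f (br x y) = heis_bracket n w (f x) (f y)" for x y
    unfolding heis_bracket_def bracket linear_cmul[OF linear_f] f_e[OF le0] heis_xi_def
    by (intro arg_cong2[where f = scaleR] sum.cong refl) (auto simp: lookup_f)
  ultimately show ?thesis
    using linear_add[OF linear_f] linear_cmul[OF linear_f] unfolding lie_isomorphic_def by blast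
qed

text \<open>Pulls the unit coordinates back along the isomorphism; \<open>e 0\<close> corresponds to
  \<xi>. The last clause gives access to the bracket table \<open>heis_bracket_tau\<close>.\<close>

lemma lie_isomorphic_heisE:
  fixes br :: "'a::real_vector \<Rightarrow> 'a \<Rightarrow> 'a"
  assumes "lie_isomorphic UNIV br (heis_carrier n) (heis_bracket n w)"
  obtains c :: "nat \<Rightarrow> 'a \<Rightarrow> real" and e :: "nat \<Rightarrow> 'a"
  where "dim (UNIV :: 'a set) = 4 * n + 1" "\<And>i. linear (c i)"
    "\<And>i j. i \<le> 4 * n \<Longrightarrow> j \<le> 4 * n \<Longrightarrow> c i (e j) = (if i = j then 1 else 0)"
    "\<And>x. x = (\<Sum>i\<le>4 * n. c i x *\<^sub>R e i)"
    "\<And>x y. br x y = (\<Sum>r = 1..n. 2 * w r *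
      (c r x * c (3 * n + r) y - c (3 * n + r) x * c r y
       + c (n + r) x * c (2 * n + r) y - c (2 * n + r) x * c (n + r) y)) *\<^sub>R e 0"
    "\<And>i j. i \<le> 4 * n \<Longrightarrow> j \<le> 4 * n \<Longrightarrow>
      c 0 (br (e i) (e j)) = Poly_Mapping.lookup (heis_bracket n w (heis_tau i) (heis_tau j)) 0"
proof -
  let ?s = "\<lambda>i. Poly_Mapping.single i (1::real)"
  obtain f where f: "bij_betw f UNIV (heis_carrier n)"
      "\<And>x y. f (x + y) = f x + f y" "\<And>c x. f (c *\<^sub>R x) = c *\<^sub>R f x"
      "\<And>x y. f (br x y) = heis_bracket n w (f x) (f y)"
    using assms unfolding lie_isomorphic_def by auto
  have linear_f: "linear f" using f by (simp add: linear_iff)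
  have "inj f" and range: "range f = heis_carrier n" using f(1) by (auto simp: bij_betw_def)
  have "?s i \<in> range f" if "i \<le> 4 * n" for i
    unfolding range heis_carrier_eq using that by (intro span_base) auto
  then have e: "f (inv f (?s i)) = ?s i" if "i \<le> 4 * n" for i
    using that by (simp add: f_inv_into_f)
  define e where "e i = inv f (?s i)" for i
  note e = e[folded e_def]
  define c where "c i x = Poly_Mapping.lookup (f x) i" for i x
  have c_large: "c i x = 0" if "\<not> i \<le> 4 * n" for i x
  proof -
    have lin: "linear (\<lambda>v::nat \<Rightarrow>\<^sub>0 real. Poly_Mapping.lookup v i)"
      by (simp add: linear_iff lookup_add lookup_scaleR)
    have "f x \<in> span (?s ` {..4 * n})" using range by (auto simp: heis_carrier_eq)
    then show ?thesis
      unfolding c_def by (rule linear_eq_0_on_span[OF lin, rotated])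
        (use that in \<open>auto simp: lookup_single when_def simp del: single_one\<close>)
  qed
  show thesis
  proof (rule that[of c e])
    show "dim (UNIV :: 'a set) = 4 * n + 1"
    proof -
      obtain B :: "'a set" where B: "independent B" "UNIV \<subseteq> span B" "card B = dim (UNIV :: 'a set)"
        using basis_exists by metis
      have "independent (f ` B)"
        using linear_independent_injective_image[OF linear_f B(1)] \<open>inj f\<close> by (metis inj_on_subset subset_UNIV)
      moreover have "span (f ` B) = span (heis_carrier n)"
        using linear_span_image[OF linear_f, of B] B(2) range
        by (metis (no_types) heis_carrier_eq span_span top.extremum_uniqueI)
      ultimately have "dim (heis_carrier n) = card (f ` B)" by (simp add: dim_eq_card)
      also have "\<dots> = dim (UNIV :: 'a set)"
        using B(3) \<open>inj f\<close> by (metis card_image inj_on_subset subset_UNIV)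
      finally show ?thesis by (simp add: dim_heis_carrier)
    qed
    show "linear (c i)" for i
      unfolding c_def by (simp add: linear_iff f lookup_add lookup_scaleR)
    show "c i (e j) = (if i = j then 1 else 0)" if "i \<le> 4 * n" "j \<le> 4 * n" for i j
      unfolding c_def using that by (auto simp: e lookup_single when_def simp del: single_one)
    show "x = (\<Sum>i\<le>4 * n. c i x *\<^sub>R e i)" for x
    proof (rule injD[OF \<open>inj f\<close>])
      have "f (\<Sum>i\<le>4 * n. c i x *\<^sub>R e i) = (\<Sum>i\<le>4 * n. c i x *\<^sub>R ?s i)"
        by (simp add: linear_sum[OF linear_f] f(3) e del: single_one)
      moreover have "f x = (\<Sum>i\<le>4 * n. c i x *\<^sub>R ?s i)"
        by (rule poly_mapping_eqI) (auto simp: lookup_sum_single c_large simp flip: c_def)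
      ultimately show "f x = f (\<Sum>i\<le>4 * n. c i x *\<^sub>R e i)" by simp
    qed
    show "br x y = (\<Sum>r = 1..n. 2 * w r *
        (c r x * c (3 * n + r) y - c (3 * n + r) x * c r y
         + c (n + r) x * c (2 * n + r) y - c (2 * n + r) x * c (n + r) y)) *\<^sub>R e 0" for x y
      by (rule injD[OF \<open>inj f\<close>]) (simp only: f(3,4) e[OF le0] heis_bracket_def heis_xi_def c_def)
    show "c 0 (br (e i) (e j)) = Poly_Mapping.lookup (heis_bracket n w (heis_tau i) (heis_tau j)) 0"
      if "i \<le> 4 * n" "j \<le> 4 * n" for i j
      using that by (simp add: c_def f(4) e heis_tau_def)
  qed
qed

section \<open>Complex Darboux bases for d\<eta>\<close>

context nilpotent_aqs
begin

definition omega :: "'a \<Rightarrow> 'a \<Rightarrow> real" where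
  "omega x y = \<eta> (br x y)"

lemma bilinear_omega: "bilinear omega"
  unfolding bilinear_def linear_iff omega_def by (simp add: br_simps eta_simps)

lemmas omega_simps =
  bilinear_ladd[OF bilinear_omega] bilinear_radd[OF bilinear_omega]
  bilinear_lmul[OF bilinear_omega] bilinear_rmul[OF bilinear_omega]
  bilinear_lneg[OF bilinear_omega] bilinear_rneg[OF bilinear_omega]
  bilinear_lsub[OF bilinear_omega] bilinear_rsub[OF bilinear_omega]
  bilinear_lzero[OF bilinear_omega] bilinear_rzero[OF bilinear_omega]

lemma linear_omega_left: "linear (\<lambda>x. omega x y)"
  using bilinear_omega by (simp add: bilinear_def)

lemma omega_skew: "omega x y = - omega y x"
  unfolding omega_def by (subst br_skew) (simp add: eta_simps)

lemma omega_xi: "omega \<xi> x = 0" "omega x \<xi> = 0"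
  by (simp_all add: omega_def xi_central eta_simps)

lemma omega_phi_phi: "omega (\<phi> x) (\<phi> y) = - omega x y"
  by (simp add: omega_def eta_br_phi_phi)

text \<open>This symmetry makes \<Omega>(x, y) = \<open>omega x y\<close> - i
  \<open>omega x (\<phi> y)\<close> complex bilinear on ker \<eta>, where i acts as \<phi>.\<close>

lemma omega_phi: "omega (\<phi> x) y = omega x (\<phi> y)"
  using omega_phi_phi[of x "\<phi> y"] by (simp add: phi_phi omega_simps omega_xi)

lemma omega_phi_self: "omega x (\<phi> x) = 0"
  using omega_phi[of x x] omega_skew[of "\<phi> x" x] by simp

text \<open>A Darboux system of the complex symplectic form whose real part is \<open>omega\<close>, the complex
  structure on \<open>ker \<eta>\<close> being \<open>\<phi>\<close>.\<close>

definition darboux :: "nat \<Rightarrow> (nat \<Rightarrow> 'a) \<Rightarrow> (nat \<Rightarrow> 'a) \<Rightarrow> bool" where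
  "darboux n X Y \<longleftrightarrow> (\<forall>i<n. \<eta> (X i) = 0 \<and> \<eta> (Y i) = 0) \<and>
    (\<forall>i<n. \<forall>j<n. omega (X i) (Y j) = (if i = j then 1 else 0) \<and>
      omega (X i) (X j) = 0 \<and> omega (Y i) (Y j) = 0 \<and>
      omega (X i) (\<phi> (Y j)) = 0 \<and> omega (X i) (\<phi> (X j)) = 0 \<and> omega (Y i) (\<phi> (Y j)) = 0)"

lemma darboux_omega:
  assumes "darboux n X Y" "i < n" "j < n"
  shows "omega (X i) (Y j) = (if i = j then 1 else 0)" "omega (X i) (X j) = 0"
    "omega (Y i) (Y j) = 0" "omega (X i) (\<phi> (Y j)) = 0" "omega (X i) (\<phi> (X j)) = 0"
    "omega (Y i) (\<phi> (Y j)) = 0" "omega (Y i) (X j) = (if i = j then - 1 else 0)"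
    "omega (Y i) (\<phi> (X j)) = 0"
  using assms omega_skew[of "Y i" "X j"] omega_skew[of "Y i" "\<phi> (X j)"]
  by (auto simp: darboux_def omega_phi)

lemma darboux_eta:
  assumes "darboux n X Y" "i < n"
  shows "\<eta> (X i) = 0" "\<eta> (Y i) = 0"
  using assms by (auto simp: darboux_def)

text \<open>Ensures that a largest Darboux system exists. The \<open>X i\<close> are independent
  because the \<open>Y i\<close> are dual to them.\<close>

lemma darboux_bounded: "darboux n X Y \<Longrightarrow> n \<le> dim (UNIV :: 'a set)"
proof -
  assume d: "darboux n X Y"
  note [simp] = darboux_omega[OF d]
  have inj: "inj_on X {..<n}"
  proof (rule inj_onI)
    fix i j assume "i \<in> {..<n}" "j \<in> {..<n}" "X i = X j"
    then show "i = j" using darboux_omega(1)[OF d, of i j] darboux_omega(1)[OF d, of j j]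
      by (auto split: if_splits)
  qed
  have "independent (X ` {..<n})"
  proof (subst independent_explicit_finite_subsets, intro allI impI ballI)
    fix S u v assume S: "S \<subseteq> X ` {..<n}" "finite S" "(\<Sum>v\<in>S. u v *\<^sub>R v) = 0" "v \<in> S"
    then obtain j where j: "j < n" "v = X j" by auto
    have "omega (\<Sum>v\<in>S. u v *\<^sub>R v) (Y j) = (\<Sum>x\<in>S. if x = v then u v else 0)"
      unfolding linear_sum[OF linear_omega_left]
    proof (rule sum.cong[OF refl])
      fix x assume "x \<in> S"
      then obtain i where "i < n" "x = X i" using S(1) by auto
      then show "omega (u x *\<^sub>R x) (Y j) = (if x = v then u v else 0)"
        using j inj by (auto simp: omega_simps inj_on_def)
    qed
    then show "u v = 0" using S by (simp add: omega_simps)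
  qed
  moreover obtain B :: "'a set" where B: "UNIV \<subseteq> span B" "card B = dim (UNIV :: 'a set)"
    using basis_exists by metis
  moreover have "finite B" using B dim_odd by (intro card_ge_0_finite) simp
  ultimately have "card (X ` {..<n}) \<le> dim (UNIV :: 'a set)"
    using independent_span_bound[of B "X ` {..<n}"] by auto
  then show ?thesis by (simp add: card_image[OF inj])
qed

text \<open>The complex symplectic projection, the sum of \<Omega>(z, \<open>Y i\<close>)
  \<open>X i\<close> - \<Omega>(z, \<open>X i\<close>) \<open>Y i\<close>, written out with i acting
  as \<phi>.\<close>

definition darboux_proj :: "nat \<Rightarrow> (nat \<Rightarrow> 'a) \<Rightarrow> (nat \<Rightarrow> 'a) \<Rightarrow> 'a \<Rightarrow> 'a" where
  "darboux_proj n X Y z = (\<Sum>i<n. omega z (Y i) *\<^sub>R X i - omega z (\<phi> (Y i)) *\<^sub>R \<phi> (X i)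
    - omega z (X i) *\<^sub>R Y i + omega z (\<phi> (X i)) *\<^sub>R \<phi> (Y i))"

lemma omega_darboux_proj:
  "omega (darboux_proj n X Y z) y = (\<Sum>i<n. omega z (Y i) * omega (X i) y
    - omega z (\<phi> (Y i)) * omega (X i) (\<phi> y) - omega z (X i) * omega (Y i) y
    + omega z (\<phi> (X i)) * omega (Y i) (\<phi> y))"
  unfolding darboux_proj_def linear_sum[OF linear_omega_left] by (simp add: omega_simps omega_phi)

lemma omega_phi_phi_right: "omega x (\<phi> (\<phi> y)) = - omega x y"
  by (simp add: phi_phi omega_simps omega_xi)

text \<open>\<open>R z\<close> is the component of \<open>z\<close> in the \<Omega>-orthogonal
  complement of the system inside ker \<eta>.\<close>

lemma darboux_residual:
  assumes d: "darboux n X Y"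
  defines "R \<equiv> \<lambda>z. z - \<eta> z *\<^sub>R \<xi> - darboux_proj n X Y z"
  shows "\<eta> (R z) = 0" and "j < n \<Longrightarrow> omega (R z) (X j) = 0" "j < n \<Longrightarrow> omega (R z) (Y j) = 0"
    "j < n \<Longrightarrow> omega (R z) (\<phi> (X j)) = 0" "j < n \<Longrightarrow> omega (R z) (\<phi> (Y j)) = 0"
proof -
  note [simp] = darboux_omega[OF d] darboux_eta[OF d] omega_phi_phi_right
  have "\<eta> (darboux_proj n X Y z) = 0"
    unfolding darboux_proj_def linear_sum[OF linear_eta] by (simp add: eta_simps eta_phi)
  then show "\<eta> (R z) = 0" unfolding R_def by (simp add: eta_simps eta_xi)
  have R: "omega (R z) y = omega z y - omega (darboux_proj n X Y z) y" for y
    unfolding R_def by (simp add: omega_simps omega_xi)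
  assume j: "j < n"
  have *: "(\<Sum>i<n. f i * (if i = j then a else 0)) = f j * a" for f :: "nat \<Rightarrow> real" and a
    using j by (simp add: if_distrib cong: if_cong)
  show "omega (R z) (X j) = 0" "omega (R z) (Y j) = 0"
    "omega (R z) (\<phi> (X j)) = 0" "omega (R z) (\<phi> (Y j)) = 0"
    unfolding R omega_darboux_proj using j by (simp_all add: sum_negf * cong: sum.cong_simp)
qed

text \<open>A largest system leaves no residual: a nonzero residual vector has, by nondegeneracy, a
  partner in the complement, and the two would enlarge the system.\<close>

lemma darboux_exists:
  assumes nondeg: "\<And>x. \<eta> x = 0 \<Longrightarrow> (\<And>y. omega x y = 0) \<Longrightarrow> x = 0"
  obtains n X Y where "darboux n X Y" "\<And>z. z = \<eta> z *\<^sub>R \<xi> + darboux_proj n X Y z"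
proof -
  have "\<exists>n. (\<exists>X Y. darboux n X Y) \<and> (\<forall>n'. (\<exists>X Y. darboux n' X Y) \<longrightarrow> n' \<le> n)"
    by (rule ex_has_greatest_nat[of _ 0 _ "Suc (dim (UNIV :: 'a set))"])
      (use darboux_bounded in \<open>auto simp: darboux_def less_Suc_eq_le\<close>)
  then obtain n X Y where d: "darboux n X Y" and max: "\<And>X Y. \<not> darboux (Suc n) X Y"
    by (metis Suc_n_not_le_n)
  define R where "R z = z - \<eta> z *\<^sub>R \<xi> - darboux_proj n X Y z" for z
  note R = darboux_residual[OF d, folded R_def]
  have "R z = 0" for z
  proof (rule ccontr)
    define x where "x = R z"
    have x: "omega x (X j) = 0" "omega x (Y j) = 0" "omega x (\<phi> (X j)) = 0"
        "omega x (\<phi> (Y j)) = 0" if "j < n" for j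
      using R(2-)[OF that] by (simp_all add: x_def)
    have eta_x: "\<eta> x = 0" using R(1) by (simp add: x_def)
    assume "R z \<noteq> 0"
    then obtain v where v: "omega x v \<noteq> 0" using nondeg[of x] eta_x unfolding x_def by blast
    \<comment> \<open>Passing to the residual of \<open>v\<close> does not change its pairing with
      \<open>x\<close>, which is orthogonal to the whole system.\<close>
    define y where "y = R v"
    have y: "omega y (X j) = 0" "omega y (Y j) = 0" "omega y (\<phi> (X j)) = 0"
        "omega y (\<phi> (Y j)) = 0" if "j < n" for j
      using R(2-)[OF that] by (simp_all add: y_def)
    have "omega (darboux_proj n X Y v) x = 0"
      unfolding omega_darboux_proj using x omega_skew[of _ x] omega_skew[of _ "\<phi> x"] omega_phi[of x]
      by (intro sum.neutral) simp
    then have xy: "omega x y \<noteq> 0"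
      using v omega_skew[of x "darboux_proj n X Y v"]
      by (simp add: y_def R_def omega_simps omega_xi)
    define a b where "a = omega x y" and "b = omega x (\<phi> y)"
    define s where "s = a\<^sup>2 + b\<^sup>2"
    have s: "s > 0" using xy by (simp add: s_def a_def sum_power2_gt_zero_iff)
    \<comment> \<open>This is \<open>y\<close> divided by the complex number \<Omega>(x, y) = a - i
      b, so that \<Omega>(x, \<open>y'\<close>) = 1.\<close>
    define y' where "y' = (a / s) *\<^sub>R y + (b / s) *\<^sub>R \<phi> y"
    have xy': "omega x y' = 1"
    proof -
      have "omega x y' = (a\<^sup>2 + b\<^sup>2) / s"
        unfolding y'_def
        by (simp add: omega_simps power2_eq_square add_divide_distrib flip: a_def b_def)
      then show ?thesis using s by (simp flip: s_def)
    qed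
    have x\<phi>y': "omega x (\<phi> y') = 0"
      unfolding y'_def by (simp add: omega_simps phi_simps omega_phi_phi_right flip: a_def b_def)
    have y': "omega y' (X j) = 0" "omega y' (Y j) = 0" "omega y' (\<phi> (X j)) = 0"
        "omega y' (\<phi> (Y j)) = 0" if "j < n" for j
      using y that unfolding y'_def by (simp_all add: omega_simps omega_phi omega_phi_phi_right)
    have "\<eta> y' = 0" unfolding y'_def y_def using R(1) by (simp add: eta_simps eta_phi)
    have left: "omega (X j) x = 0" "omega (Y j) x = 0" "omega (X j) y' = 0" "omega (Y j) y' = 0"
      "omega (X j) (\<phi> x) = 0" "omega (Y j) (\<phi> x) = 0" "omega (X j) (\<phi> y') = 0"
      "omega (Y j) (\<phi> y') = 0" if "j < n" for j
      using x y' that omega_skew[of _ x] omega_skew[of _ y'] omega_phi[of "X j"] omega_phi[of "Y j"]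
      by (metis neg_equal_zero neg_0_equal_iff_equal)+
    have self: "omega u u = 0" for u using omega_skew[of u u] by simp
    have "darboux (Suc n) (X(n := x)) (Y(n := y'))"
      unfolding darboux_def
      using d[unfolded darboux_def] x eta_x y' left xy' x\<phi>y' \<open>\<eta> y' = 0\<close>
      by (auto simp: less_Suc_eq self omega_phi_self)
    then show False using max by blast
  qed
  then have "z = \<eta> z *\<^sub>R \<xi> + darboux_proj n X Y z" for z
    unfolding R_def by (metis add.commute diff_add_cancel diff_diff_add eq_iff_diff_eq_0)
  with d that show thesis by blast
qed

lemma lie_isomorphic_heis:
  assumes nondeg: "\<And>x. \<eta> x = 0 \<Longrightarrow> (\<And>y. \<eta> (br x y) = 0) \<Longrightarrow> x = 0"
  obtains n where "lie_isomorphic UNIV br (heis_carrier n) (heis_bracket n (\<lambda>_. 1 / 2))"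
proof -
  obtain n X Y where d: "darboux n X Y" and expand: "\<And>z. z = \<eta> z *\<^sub>R \<xi> + darboux_proj n X Y z"
    using darboux_exists nondeg unfolding omega_def by metis
  \<comment> \<open>The blocks are X, \<phi> X, - \<phi> Y, Y. By anti-invariance the minus sign
    makes \<open>omega\<close> equal to 1 on the second and third block as well as on the first and
    fourth, in accordance with weight 1/2. The functionals \<open>c\<close> below are the
    duals.\<close>
  define e where "e i = (if i = 0 then \<xi> else if i \<le> n then X (i - 1)
    else if i \<le> 2 * n then \<phi> (X (i - n - 1)) else if i \<le> 3 * n then - \<phi> (Y (i - 2 * n - 1))
    else Y (i - 3 * n - 1))" for i
  define c where "c i z = (if i = 0 then \<eta> z else if i \<le> n then omega z (Y (i - 1))
    else if i \<le> 2 * n then - omega z (\<phi> (Y (i - n - 1)))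
    else if i \<le> 3 * n then - omega z (\<phi> (X (i - 2 * n - 1)))
    else - omega z (X (i - 3 * n - 1)))" for i z
  have c: "c 0 = \<eta>" "\<And>k. k < n \<Longrightarrow> c (Suc k) = (\<lambda>z. omega z (Y k))"
    "\<And>k. k < n \<Longrightarrow> c (n + Suc k) = (\<lambda>z. - omega z (\<phi> (Y k)))"
    "\<And>k. k < n \<Longrightarrow> c (2 * n + Suc k) = (\<lambda>z. - omega z (\<phi> (X k)))"
    "\<And>k. k < n \<Longrightarrow> c (3 * n + Suc k) = (\<lambda>z. - omega z (X k))"
    unfolding c_def by (auto simp: fun_eq_iff)
  have e: "e 0 = \<xi>" "\<And>k. k < n \<Longrightarrow> e (Suc k) = X k" "\<And>k. k < n \<Longrightarrow> e (n + Suc k) = \<phi> (X k)"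
    "\<And>k. k < n \<Longrightarrow> e (2 * n + Suc k) = - \<phi> (Y k)" "\<And>k. k < n \<Longrightarrow> e (3 * n + Suc k) = Y k"
    unfolding e_def by auto
  have index: "i = 0 \<or> (\<exists>k<n. i = Suc k \<or> i = n + Suc k \<or> i = 2 * n + Suc k \<or> i = 3 * n + Suc k)"
    if "i \<le> 4 * n" for i
  proof -
    consider "i = 0" | "0 < i" "i \<le> n" | "n < i" "i \<le> 2 * n" | "2 * n < i" "i \<le> 3 * n"
      | "3 * n < i" using that by linarith
    then show ?thesis
    proof cases
      case 2
      then have "i - 1 < n" "i = Suc (i - 1)" by auto
      then show ?thesis by blast
    next
      case 3
      then have "i - n - 1 < n" "i = n + Suc (i - n - 1)" by auto
      then show ?thesis by blast
    next
      case 4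
      then have "i - 2 * n - 1 < n" "i = 2 * n + Suc (i - 2 * n - 1)" by auto
      then show ?thesis by blast
    next
      case 5
      then have "i - 3 * n - 1 < n" "i = 3 * n + Suc (i - 3 * n - 1)" using that by auto
      then show ?thesis by blast
    qed simp
  qed
  have "linear (c i)" for i
    unfolding c_def by (auto simp: linear_iff omega_simps eta_simps)
  moreover have "c i (e j) = (if i = j then 1 else 0)" if "i \<le> 4 * n" "j \<le> 4 * n" for i j
    using index[OF that(1)] index[OF that(2)]
    by (elim disjE exE conjE; simp only: c e; simp add: darboux_omega[OF d] darboux_eta[OF d]
        omega_phi omega_phi_phi_right omega_simps omega_xi eta_simps eta_xi eta_phi)
  moreover have "z = 0" if z: "\<And>i. i \<le> 4 * n \<Longrightarrow> c i z = 0" for z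
  proof -
    have "omega z (Y k) = 0" "omega z (\<phi> (Y k)) = 0" "omega z (\<phi> (X k)) = 0" "omega z (X k) = 0"
      if "k < n" for k
      using z[of "Suc k"] z[of "n + Suc k"] z[of "2 * n + Suc k"] z[of "3 * n + Suc k"] that
      by (simp_all only: c) simp_all
    moreover have "\<eta> z = 0" using z[of 0] by (simp add: c)
    ultimately show ?thesis by (subst expand) (simp add: darboux_proj_def)
  qed
  moreover have "br x y = (\<Sum>r = 1..n. 2 * (1 / 2) *
      (c r x * c (3 * n + r) y - c (3 * n + r) x * c r y
       + c (n + r) x * c (2 * n + r) y - c (2 * n + r) x * c (n + r) y)) *\<^sub>R e 0" for x y
  proof -
    have "omega x y = omega (\<eta> x *\<^sub>R \<xi> + darboux_proj n X Y x) y" using expand by simp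
    also have "\<dots> = omega (darboux_proj n X Y x) y" by (simp add: omega_simps omega_xi)
    also have "\<dots> = (\<Sum>k<n. c (Suc k) x * c (3 * n + Suc k) y - c (3 * n + Suc k) x * c (Suc k) y
       + c (n + Suc k) x * c (2 * n + Suc k) y - c (2 * n + Suc k) x * c (n + Suc k) y)"
      unfolding omega_darboux_proj
    proof (rule sum.cong[OF refl])
      fix k assume "k \<in> {..<n}"
      moreover have "omega u y = - omega y u" "omega u (\<phi> y) = - omega y (\<phi> u)" for u
        using omega_skew omega_phi by metis+
      ultimately show "omega x (Y k) * omega (X k) y - omega x (\<phi> (Y k)) * omega (X k) (\<phi> y)
          - omega x (X k) * omega (Y k) y + omega x (\<phi> (X k)) * omega (Y k) (\<phi> y) =
        c (Suc k) x * c (3 * n + Suc k) y - c (3 * n + Suc k) x * c (Suc k) y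
         + c (n + Suc k) x * c (2 * n + Suc k) y - c (2 * n + Suc k) x * c (n + Suc k) y"
        by (simp only: c lessThan_iff)
    qed
    finally show ?thesis
      using br_eq[of x y] by (simp add: e omega_def sum.atLeast1_atMost_eq)
  qed
  ultimately show thesis
    using lie_isomorphic_heisI[of c n e br "\<lambda>_. 1 / 2"] that by blast
qed

end

section \<open>The structure on a weighted Heisenberg algebra\<close>

lemma sum_four_blocks:
  fixes F :: "nat \<Rightarrow> 'a::comm_monoid_add"
  shows "(\<Sum>i\<le>4 * n. F i) = F 0 + (\<Sum>r = 1..n. F r + F (n + r) + F (2 * n + r) + F (3 * n + r))"
proof -
  have "{..4 * n} = insert 0 {1..4 * n}" by auto
  then have "(\<Sum>i\<le>4 * n. F i) = F 0 + sum F {1..4 * n}" by simp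
  also have "sum F {1..4 * n} = sum F {1..n} + sum F {n + 1..n + n} + sum F {2 * n + 1..2 * n + n}
      + sum F {3 * n + 1..3 * n + n}"
    using sum.ub_add_nat[of 1 n F n] sum.ub_add_nat[of 1 "2 * n" F n] sum.ub_add_nat[of 1 "3 * n" F n]
    by (simp add: mult_2[symmetric])
  also have "\<dots> = (\<Sum>r = 1..n. F r + F (n + r) + F (2 * n + r) + F (3 * n + r))"
    using sum.shift_bounds_cl_nat_ivl[of F 1 n n] sum.shift_bounds_cl_nat_ivl[of F 1 "2 * n" n]
      sum.shift_bounds_cl_nat_ivl[of F 1 "3 * n" n]
    by (simp add: sum.distrib add.commute)
  finally show ?thesis .
qed

text \<open>Brackets are multiples of \<open>e 0\<close>, which \<Phi> annihilates, so d\<Phi> = 0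
  is immediate. The condition on N reduces to \<open>K_phi\<close>, and the nonzero weights make
  d\<eta> nondegenerate on ker \<eta>.\<close>

lemma heis_admits_aqs:
  fixes br :: "'a::real_vector \<Rightarrow> 'a \<Rightarrow> 'a"
  assumes w: "\<forall>r\<in>{1..n}. w r \<noteq> 0"
    and iso: "lie_isomorphic UNIV br (heis_carrier n) (heis_bracket n w)"
  shows "\<exists>m \<phi> \<xi> \<eta> g. anti_quasi_sasakian br m \<phi> \<xi> \<eta> g \<and> maximal_rank br m \<eta>"
proof -
  obtain c :: "nat \<Rightarrow> 'a \<Rightarrow> real" and e :: "nat \<Rightarrow> 'a"
    where dim: "dim (UNIV :: 'a set) = 4 * n + 1" and lin: "\<And>i. linear (c i)"
    and dual: "\<And>i j. i \<le> 4 * n \<Longrightarrow> j \<le> 4 * n \<Longrightarrow> c i (e j) = (if i = j then 1 else 0)"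
    and expand: "\<And>x. x = (\<Sum>i\<le>4 * n. c i x *\<^sub>R e i)"
    and bracket: "\<And>x y. br x y = (\<Sum>r = 1..n. 2 * w r *
      (c r x * c (3 * n + r) y - c (3 * n + r) x * c r y
       + c (n + r) x * c (2 * n + r) y - c (2 * n + r) x * c (n + r) y)) *\<^sub>R e 0"
    and bracket_e: "\<And>i j. i \<le> 4 * n \<Longrightarrow> j \<le> 4 * n \<Longrightarrow>
      c 0 (br (e i) (e j)) = Poly_Mapping.lookup (heis_bracket n w (heis_tau i) (heis_tau j)) 0"
    using lie_isomorphic_heisE[OF iso] by blast
  note c_simps = linear_add[OF lin] linear_diff[OF lin] linear_cmul[OF lin] linear_neg[OF lin] linear_0[OF lin]
  define K where "K x y = (\<Sum>r = 1..n. 2 * w r *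
      (c r x * c (3 * n + r) y - c (3 * n + r) x * c r y
       + c (n + r) x * c (2 * n + r) y - c (2 * n + r) x * c (n + r) y))" for x y
  note bracket = bracket[folded K_def]
  have coord_eqI: "x = y" if "\<And>i. i \<le> 4 * n \<Longrightarrow> c i x = c i y" for x y
    using that by (subst expand, subst (2) expand) simp
  \<comment> \<open>Coordinates of the map \<phi> with \<open>e r\<close> to
    \<open>e (n + r)\<close>, \<open>e (2 * n + r)\<close> to \<open>e (3 * n + r)\<close>, their
    images to the negatives, and \<open>e 0\<close> to 0.\<close>
  define d where "d i x = (if i = 0 then 0 else if i \<le> n then - c (n + i) x
    else if i \<le> 2 * n then c (i - n) x else if i \<le> 3 * n then - c (n + i) x else c (i - n) x)" for i x
  define \<phi> where "\<phi> x = (\<Sum>i\<le>4 * n. d i x *\<^sub>R e i)" for x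
  define g where "g x y = (\<Sum>i\<le>4 * n. c i x * c i y)" for x y
  have c_phi: "c j (\<phi> x) = d j x" if "j \<le> 4 * n" for j x
  proof -
    have "c j (\<phi> x) = (\<Sum>i\<le>4 * n. if i = j then d i x else 0)"
      unfolding \<phi>_def linear_sum[OF lin] using that by (intro sum.cong) (auto simp: c_simps dual)
    then show ?thesis using that by simp
  qed
  have d_blocks: "d 0 x = 0" "r \<in> {1..n} \<Longrightarrow> d r x = - c (n + r) x"
    "r \<in> {1..n} \<Longrightarrow> d (n + r) x = c r x" "r \<in> {1..n} \<Longrightarrow> d (2 * n + r) x = - c (3 * n + r) x"
    "r \<in> {1..n} \<Longrightarrow> d (3 * n + r) x = c (2 * n + r) x" for r x
    unfolding d_def by auto
  have c_phi_blocks: "c 0 (\<phi> x) = 0" "r \<in> {1..n} \<Longrightarrow> c r (\<phi> x) = - c (n + r) x"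
    "r \<in> {1..n} \<Longrightarrow> c (n + r) (\<phi> x) = c r x" "r \<in> {1..n} \<Longrightarrow> c (2 * n + r) (\<phi> x) = - c (3 * n + r) x"
    "r \<in> {1..n} \<Longrightarrow> c (3 * n + r) (\<phi> x) = c (2 * n + r) x" for r x
    by (simp_all add: c_phi d_blocks)
  \<comment> \<open>Up to sign, \<phi> exchanges the products for the index pairs
    \<open>(r, 3 * n + r)\<close> and \<open>(n + r, 2 * n + r)\<close>.\<close>
  have K_phi: "K (\<phi> x) (\<phi> y) = - K x y" for x y
    unfolding K_def sum_negf[symmetric]
    by (rule sum.cong) (simp_all only: c_phi_blocks, simp add: algebra_simps)
  have linear_d: "linear (d i)" for i
    unfolding d_def by (auto simp: linear_iff c_simps)
  have linear_phi: "linear \<phi>"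
    unfolding \<phi>_def linear_iff
    by (simp add: linear_add[OF linear_d] linear_cmul[OF linear_d] scaleR_add_left sum.distrib
        scaleR_sum_right)
  have phi_e0: "\<phi> (e 0) = 0"
    by (rule coord_eqI) (auto simp: c_phi c_simps d_def dual)
  have bilinear_g: "bilinear g"
    unfolding bilinear_def linear_iff g_def
    by (auto simp: c_simps sum.distrib sum_distrib_left algebra_simps)
  interpret almost_contact_metric "2 * n" \<phi> "e 0" "c 0" g
  proof (rule almost_contact_metric.intro)
    show "dim (UNIV :: 'a set) = 2 * (2 * n) + 1" using dim by simp
    show "linear \<phi>" "linear (c 0)" by (fact linear_phi lin)+
    show "c 0 (e 0) = 1" by (simp add: dual)
    show "\<phi> (\<phi> x) = - x + c 0 x *\<^sub>R e 0" for x
    proof (rule coord_eqI)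
      fix i assume "i \<le> 4 * n"
      then show "c i (\<phi> (\<phi> x)) = c i (- x + c 0 x *\<^sub>R e 0)"
        by (auto simp: c_simps c_phi dual) (auto simp: d_def c_phi)
    qed
    show "g (\<phi> x) (\<phi> y) = g x y - c 0 x * c 0 y" for x y
    proof -
      have "(\<Sum>r = 1..n. c r (\<phi> x) * c r (\<phi> y) + c (n + r) (\<phi> x) * c (n + r) (\<phi> y)
          + c (2 * n + r) (\<phi> x) * c (2 * n + r) (\<phi> y) + c (3 * n + r) (\<phi> x) * c (3 * n + r) (\<phi> y)) =
        (\<Sum>r = 1..n. c r x * c r y + c (n + r) x * c (n + r) y
          + c (2 * n + r) x * c (2 * n + r) y + c (3 * n + r) x * c (3 * n + r) y)"
        by (rule sum.cong) (simp_all add: c_phi_blocks)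
      then show ?thesis unfolding g_def sum_four_blocks by (simp add: c_phi_blocks)
    qed
    have "0 < g x x" if "x \<noteq> 0" for x
    proof -
      have "\<exists>i\<le>4 * n. c i x \<noteq> 0" using coord_eqI[of x 0] that by (auto simp: c_simps)
      then obtain i where "i \<le> 4 * n" "c i x \<noteq> 0" by blast
      then show ?thesis unfolding g_def by (intro sum_pos2[of _ i]) (auto simp: zero_less_mult_iff)
    qed
    then show "is_inner_product g"
      using bilinear_g by (auto simp: is_inner_product_def g_def mult.commute)
  qed
  have "anti_quasi_sasakian br (2 * n) \<phi> (e 0) (c 0) g"
  proof
    have g_e0: "g (a *\<^sub>R e 0) (\<phi> x) = 0" for a x
    proof -
      have "g (e 0) (\<phi> x) = 0"
        unfolding g_def by (intro sum.neutral) (auto simp: dual c_phi_blocks)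
      then show ?thesis by (simp add: bilinear_lmul[OF bilinear_g])
    qed
    show "ce_d2 br (fundamental_form \<phi> g) x y z = 0" for x y z
      unfolding ce_d2_def fundamental_form_def bracket by (simp add: g_e0)
    show "N_tensor br \<phi> (e 0) (c 0) x y = (2 * ce_d1 br (c 0) x y) *\<^sub>R e 0" for x y
      unfolding N_tensor_def ce_d1_def bracket K_phi
      by (simp add: linear_cmul[OF linear_phi] linear_0[OF linear_phi] phi_e0 c_simps dual)
        (simp flip: scaleR_add_left scaleR_minus_left scaleR_diff_left)
  qed
  moreover have "maximal_rank br (2 * n) (c 0)"
  proof -
    \<comment> \<open>\<open>e (q i)\<close> is the bracket partner of \<open>e (i + 1)\<close>. The
      factor \<open>s i\<close> absorbs the weight, whatever its sign, together with the minus sign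
      of \<open>ce_d1\<close>, so each pair has d\<eta>-value 1. The sequence \<open>v\<close> lists
      \<open>e 0\<close> and then these pairs.\<close>
    define q where "q i = (if i < n then 3 * n + i + 1 else n + i + 1)" for i
    define s where "s i = - 1 / (2 * w (if i < n then i + 1 else i + 1 - n))" for i
    define v where "v k = (if k = 0 then e 0 else if odd k then e ((k - 1) div 2 + 1)
      else s ((k - 1) div 2) *\<^sub>R e (q ((k - 1) div 2)))" for k
    have skew: "br x y = - br y x" for x y
      unfolding bracket K_def scaleR_minus_left[symmetric] sum_negf[symmetric]
      by (intro arg_cong[where f = "\<lambda>c. c *\<^sub>R e 0"] sum.cong refl) (simp add: algebra_simps)
    have br_scale: "br (a *\<^sub>R x) y = a *\<^sub>R br x y" "br x (a *\<^sub>R y) = a *\<^sub>R br x y" for a x y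
      unfolding bracket K_def scaleR_scaleR sum_distrib_left
      by (intro arg_cong[where f = "\<lambda>c. c *\<^sub>R e 0"] sum.cong refl; simp add: c_simps algebra_simps)+
    have val: "c 0 (br (e i) (e j)) = (if i \<in> {1..n} \<and> j = 3 * n + i then 2 * w i
       else if i \<in> {n + 1..2 * n} \<and> j = n + i then 2 * w (i - n) else 0)"
      if "i \<in> {1..4 * n}" "j \<in> {1..4 * n}" "i < j" for i j
      using that heis_bracket_tau[OF that, of w]
      by (simp add: bracket_e lookup_scaleR heis_xi_def del: single_one)
    show ?thesis
    proof (rule maximal_rank_of_symplectic_basis[where v = v])
      show "br x y = - br y x" for x y by (fact skew)
      show "linear (c 0)" by (fact lin)
      show "c 0 (v 0) = 1" by (simp add: v_def dual)
      show "c 0 (v i) = 0" if "0 < i" "i \<le> 2 * (2 * n)" for i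
        using that by (auto simp: v_def q_def c_simps dual)
      show "0 < ce_d1 br (c 0) (v (2 * i + 1)) (v (2 * i + 2))" if "i < 2 * n" for i
      proof -
        define W where "W = w (if i < n then i + 1 else i + 1 - n)"
        have "c 0 (br (e (i + 1)) (e (q i))) = 2 * W"
          using that unfolding W_def by (subst val) (auto simp: q_def)
        moreover have "(if i < n then i + 1 else i + 1 - n) \<in> {1..n}" using that by auto
        then have "W \<noteq> 0" using w unfolding W_def by blast
        moreover have "s i = - 1 / (2 * W)" unfolding s_def W_def ..
        moreover have "v (2 * i + 1) = e (i + 1)" "v (2 * i + 2) = s i *\<^sub>R e (q i)"
          by (simp_all add: v_def)
        ultimately show ?thesis
          by (simp only: ce_d1_def br_scale c_simps) simp
      qed
      show "ce_d1 br (c 0) (v (a + 1)) (v (b + 1)) = 0"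
        if "a < 2 * (2 * n)" "b < 2 * (2 * n)" "a div 2 \<noteq> b div 2" for a b
      proof -
        \<comment> \<open>Up to the scalar \<open>t k\<close>, entry \<open>k + 1\<close> of
          \<open>v\<close> is the basis vector number \<open>p k\<close>; what remains is that
          entries of different pairs are never bracket partners.\<close>
        define p where "p k = (if even k then k div 2 + 1 else q (k div 2))" for k :: nat
        define t where "t k = (if even k then 1 else s (k div 2))" for k :: nat
        have v: "v (k + 1) = t k *\<^sub>R e (p k)" for k
          by (simp add: v_def p_def t_def)
        have p_range: "p k \<in> {1..4 * n}" if "k < 2 * (2 * n)" for k
          using that by (auto simp: p_def q_def)
        have p_ne: "p k \<noteq> p l" and p_partner: "p k \<in> {1..n} \<Longrightarrow> p l \<noteq> 3 * n + p k"
          "p k \<in> {n + 1..2 * n} \<Longrightarrow> p l \<noteq> n + p k"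
          if "k < 2 * (2 * n)" "l < 2 * (2 * n)" "k div 2 \<noteq> l div 2" for k l
          using that by (auto simp: p_def q_def split: if_splits)
        have zero: "c 0 (br (e (p k)) (e (p l))) = 0"
          if "k < 2 * (2 * n)" "l < 2 * (2 * n)" "k div 2 \<noteq> l div 2" "p k < p l" for k l
          using p_partner[OF that(1-3)] by (subst val[OF p_range p_range]) (use that in auto)
        have "c 0 (br (e (p a)) (e (p b))) = 0"
        proof (cases "p a < p b")
          case True
          then show ?thesis using zero that by blast
        next
          case False
          then have "p b < p a" using p_ne[OF that] by simp
          then have "c 0 (br (e (p b)) (e (p a))) = 0" using zero that by metis
          then show ?thesis using skew[of "e (p a)"] by (simp add: c_simps)
        qed
        then show ?thesis unfolding v ce_d1_def by (simp add: br_scale c_simps)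
      qed
    qed
  qed
  ultimately show ?thesis by blast
qed

theorem theorem1p2:
  fixes br :: "'a::real_vector \<Rightarrow> 'a \<Rightarrow> 'a"
  assumes lie: "lie_algebra UNIV br"
    and fin_dim: "\<exists>B :: 'a set. finite B \<and> span B = UNIV"
    and nilp: "lie_nilpotent UNIV br"
  shows "(\<exists>m \<phi> \<xi> \<eta> g. anti_quasi_sasakian br m \<phi> \<xi> \<eta> g \<and> maximal_rank br m \<eta>) \<longleftrightarrow>
    (\<exists>(n::nat) (w::nat \<Rightarrow> real). (\<forall>r\<in>{1..n}. w r \<noteq> 0) \<and>
       lie_isomorphic UNIV br (heis_carrier n) (heis_bracket n w))"
proof
  assume "\<exists>m \<phi> \<xi> \<eta> g. anti_quasi_sasakian br m \<phi> \<xi> \<eta> g \<and> maximal_rank br m \<eta>"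
  then obtain m \<phi> \<xi> \<eta> g where aqs: "anti_quasi_sasakian br m \<phi> \<xi> \<eta> g"
    and rank: "maximal_rank br m \<eta>" by blast
  interpret nilpotent_aqs br m \<phi> \<xi> \<eta> g
    using aqs lie nilp by (simp add: nilpotent_aqs_def nilpotent_aqs_axioms_def)
  have "bilinear (ce_d1 br \<eta>)"
    unfolding bilinear_def linear_iff ce_d1_def by (simp add: br_simps eta_simps)
  moreover have "ce_d1 br \<eta> x y = 0 \<and> ce_d1 br \<eta> y x = 0" if "\<And>y. \<eta> (br x y) = 0" for x y
    using that br_skew[of y x] by (simp add: ce_d1_def eta_simps)
  ultimately have "x = 0" if "\<eta> x = 0" "\<And>y. \<eta> (br x y) = 0" for x
    using maximal_rank_imp_nondegenerate[OF dim_odd linear_eta _ rank] that by blast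
  then obtain n where "lie_isomorphic UNIV br (heis_carrier n) (heis_bracket n (\<lambda>_. 1 / 2))"
    using lie_isomorphic_heis by blast
  then show "\<exists>(n::nat) (w::nat \<Rightarrow> real). (\<forall>r\<in>{1..n}. w r \<noteq> 0) \<and>
      lie_isomorphic UNIV br (heis_carrier n) (heis_bracket n w)"
    by (intro exI[of _ n] exI[of _ "\<lambda>_. 1 / 2"]) simp
next
  assume "\<exists>(n::nat) (w::nat \<Rightarrow> real). (\<forall>r\<in>{1..n}. w r \<noteq> 0) \<and>
      lie_isomorphic UNIV br (heis_carrier n) (heis_bracket n w)"
  then show "\<exists>m \<phi> \<xi> \<eta> g. anti_quasi_sasakian br m \<phi> \<xi> \<eta> g \<and> maximal_rank br m \<eta>"
    using heis_admits_aqs by blast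
qed

end
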